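(* Let $\mathcal{M}$ be an injective factor acting on a Hilbert space $H$, let $x\in H$ be a unit vector which is separating and cyclic for $\mathcal{M}$, and let $E\in B(H)$ be the rank one projection onto $\mathbb{C}x$. Let $k\in\mathbb{N}$, $A_1,\dots,A_k,B_1,\dots,B_k\in\mathcal{M}$, and let $\phi\colon\mathcal{M}\to\mathcal{M}$ be defined by $\phi(C)=\sum_{i=1}^k A_iCB_i$. Put $D_\phi=\sum_{i=1}^k B_iEA_i$ and $C_\phi=\sum_{i=1}^k A_iEB_i$ in $B(H)$. Then the following conditions are equivalent: (i) $\phi$ is completely positive. (ii) The map $C\mapsto\sum_{i=1}^k A_iCB_i$ is positive on $B(H)$. (iii) There are finitely many operators $V_j\in\mathcal{M}$ such that $\phi(C)=\sum_j V_j^*CV_j$ for all $C\in\mathcal{M}$. (iv) $D_\phi\geq 0$. (v) $C_\phi\geq 0$.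
   Context: A factor is a von Neumann algebra with trivial center. A vector $x$ is cyclic for $\mathcal{M}$ if $\mathcal{M}x$ is dense in $H$, and separating if $A\in\mathcal{M}$, $Ax=0$ imply $A=0$. A von Neumann algebra $\mathcal{M}\subset B(H)$ is injective if there is a norm one projection (conditional expectation) of $B(H)$ onto $\mathcal{M}$. A linear map is positive if it sends positive operators to positive operators. For $D\in B(H)$, $D\geq 0$ means that $D$ is a positive operator. *)

theory Defs
  imports "HOL-Analysis.Analysis"
begin

section \<open>Complex Hilbert spaces\<close>

text \<open>
  The inner product is linear in its first argument. Completeness, the norm topology and the
  real vector space structure come from \<^class>\<open>banach\<close>. Positive definiteness of the inner
  product follows from the last axiom.
\<close>

class complex_hilbert = banach +
  fixes scaleC :: "complex \<Rightarrow> 'a \<Rightarrow> 'a" (infixr "*\<^sub>C" 75)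
    and cinner :: "'a \<Rightarrow> 'a \<Rightarrow> complex"
  assumes scaleC_add_right: "c *\<^sub>C (x + y) = c *\<^sub>C x + c *\<^sub>C y"
    and scaleC_add_left: "(c + d) *\<^sub>C x = c *\<^sub>C x + d *\<^sub>C x"
    and scaleC_scaleC: "c *\<^sub>C d *\<^sub>C x = (c * d) *\<^sub>C x"
    and scaleC_of_real: "complex_of_real r *\<^sub>C x = r *\<^sub>R x"
    and cinner_add_left: "cinner (x + y) z = cinner x z + cinner y z"
    and cinner_scaleC_left: "cinner (c *\<^sub>C x) y = c * cinner x y"
    and cinner_commute: "cinner x y = cnj (cinner y x)"
    and cinner_self: "cinner x x = complex_of_real ((norm x)\<^sup>2)"

instantiation complex :: complex_hilbert
begin

definition scaleC_complex :: "complex \<Rightarrow> complex \<Rightarrow> complex"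
  where "scaleC_complex c z = c * z"

definition cinner_complex :: "complex \<Rightarrow> complex \<Rightarrow> complex"
  where "cinner_complex z w = z * cnj w"

instance
  by standard
    (auto simp: scaleC_complex_def cinner_complex_def algebra_simps scaleR_conv_of_real
      complex_norm_square simp del: of_real_power)

end

lemma norm_scaleC: "norm (c *\<^sub>C (x::'a::complex_hilbert)) = cmod c * norm x"
proof -
  have "cinner (c *\<^sub>C x) (c *\<^sub>C x) = c * cnj (cinner (c *\<^sub>C x) x)"
    by (metis cinner_commute cinner_scaleC_left)
  also have "\<dots> = c * cnj c * cinner x x"
    by (simp add: cinner_scaleC_left cinner_self)
  finally have "complex_of_real ((norm (c *\<^sub>C x))\<^sup>2) = complex_of_real ((cmod c * norm x)\<^sup>2)"
    by (simp add: cinner_self power_mult_distrib flip: complex_norm_square)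
  then have "(norm (c *\<^sub>C x))\<^sup>2 = (cmod c * norm x)\<^sup>2"
    using of_real_eq_iff by blast
  then show ?thesis
    by (simp add: power2_eq_iff_nonneg)
qed

lemma bounded_linear_scaleC: "bounded_linear (\<lambda>x::'a::complex_hilbert. c *\<^sub>C x)"
proof (rule bounded_linear_intro[where K = "cmod c"])
  show "c *\<^sub>C (r *\<^sub>R x) = r *\<^sub>R (c *\<^sub>C x)" for r and x :: 'a
    by (simp add: scaleC_scaleC mult.commute flip: scaleC_of_real)
qed (auto simp: scaleC_add_right norm_scaleC mult.commute)


section \<open>Bounded operators\<close>

text \<open>
  The type \<^typ>\<open>'h \<Rightarrow>\<^sub>L 'h\<close> consists of all real-linear bounded maps; the algebra \<open>B(H)\<close> is
  the subset of complex-linear ones. The norm of \<^typ>\<open>'h \<Rightarrow>\<^sub>L 'h\<close> is the operator norm.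
\<close>

definition bounded_ops :: "('h::complex_hilbert \<Rightarrow>\<^sub>L 'h) set"
  where "bounded_ops = {T. \<forall>c x. blinfun_apply T (c *\<^sub>C x) = c *\<^sub>C blinfun_apply T x}"

text \<open>The operator \<open>c\<cdot>1\<close>; the scalar multiple \<open>c\<cdot>T\<close> is \<open>scalar_op c o\<^sub>L T\<close>.\<close>

lift_definition scalar_op :: "complex \<Rightarrow> 'h::complex_hilbert \<Rightarrow>\<^sub>L 'h"
  is "\<lambda>c x. c *\<^sub>C x"
  by (rule bounded_linear_scaleC)

text \<open>Meaningful for \<open>T \<in> bounded_ops\<close>, where existence is the Riesz representation theorem.\<close>

definition adj :: "('h::complex_hilbert \<Rightarrow>\<^sub>L 'h) \<Rightarrow> 'h \<Rightarrow>\<^sub>L 'h"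
  where "adj T = (THE S. \<forall>x y. cinner (blinfun_apply T x) y = cinner x (blinfun_apply S y))"

definition positive_op :: "('h::complex_hilbert \<Rightarrow>\<^sub>L 'h) \<Rightarrow> bool"
  where "positive_op T \<longleftrightarrow> T \<in> bounded_ops \<and> (\<forall>x. cinner (blinfun_apply T x) x \<in> \<real>\<^sub>\<ge>\<^sub>0)"

definition orth_projection_onto :: "'h::complex_hilbert set \<Rightarrow> ('h \<Rightarrow>\<^sub>L 'h) \<Rightarrow> bool"
  where "orth_projection_onto K E \<longleftrightarrow>
    E \<in> bounded_ops \<and> E o\<^sub>L E = E \<and> adj E = E \<and> range (blinfun_apply E) = K"


section \<open>Von Neumann algebras\<close>

definition commutant :: "('h::complex_hilbert \<Rightarrow>\<^sub>L 'h) set \<Rightarrow> ('h \<Rightarrow>\<^sub>L 'h) set"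
  where "commutant M = {T \<in> bounded_ops. \<forall>A\<in>M. T o\<^sub>L A = A o\<^sub>L T}"

definition von_neumann_algebra :: "('h::complex_hilbert \<Rightarrow>\<^sub>L 'h) set \<Rightarrow> bool"
  where "von_neumann_algebra M \<longleftrightarrow>
    M \<subseteq> bounded_ops \<and>
    (\<forall>A\<in>M. \<forall>B\<in>M. A + B \<in> M) \<and>
    (\<forall>c. \<forall>A\<in>M. scalar_op c o\<^sub>L A \<in> M) \<and>
    (\<forall>A\<in>M. \<forall>B\<in>M. A o\<^sub>L B \<in> M) \<and>
    (\<forall>A\<in>M. adj A \<in> M) \<and>
    commutant (commutant M) = M"

definition factor :: "('h::complex_hilbert \<Rightarrow>\<^sub>L 'h) set \<Rightarrow> bool"
  where "factor M \<longleftrightarrow> von_neumann_algebra M \<and> M \<inter> commutant M = range scalar_op"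

definition cyclic_vector :: "('h::complex_hilbert \<Rightarrow>\<^sub>L 'h) set \<Rightarrow> 'h \<Rightarrow> bool"
  where "cyclic_vector M x \<longleftrightarrow> closure ((\<lambda>A. blinfun_apply A x) ` M) = UNIV"

definition separating_vector :: "('h::complex_hilbert \<Rightarrow>\<^sub>L 'h) set \<Rightarrow> 'h \<Rightarrow> bool"
  where "separating_vector M x \<longleftrightarrow> (\<forall>A\<in>M. blinfun_apply A x = 0 \<longrightarrow> A = 0)"


section \<open>Maps between spaces of operators\<close>

definition clinear_on ::
  "('h::complex_hilbert \<Rightarrow>\<^sub>L 'h) set \<Rightarrow> (('h \<Rightarrow>\<^sub>L 'h) \<Rightarrow> 'h \<Rightarrow>\<^sub>L 'h) \<Rightarrow> bool"
  where "clinear_on S \<Phi> \<longleftrightarrow>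
    (\<forall>A\<in>S. \<forall>B\<in>S. \<Phi> (A + B) = \<Phi> A + \<Phi> B) \<and>
    (\<forall>c. \<forall>A\<in>S. \<Phi> (scalar_op c o\<^sub>L A) = scalar_op c o\<^sub>L \<Phi> A)"

text \<open>
  A contractive projection onto a unital algebra fixes the identity, so on a nonzero space its
  norm is exactly one.
\<close>

definition norm_one_projection ::
  "('h::complex_hilbert \<Rightarrow>\<^sub>L 'h) set \<Rightarrow> (('h \<Rightarrow>\<^sub>L 'h) \<Rightarrow> 'h \<Rightarrow>\<^sub>L 'h) \<Rightarrow> bool"
  where "norm_one_projection M P \<longleftrightarrow>
    clinear_on bounded_ops P \<and>
    (\<forall>T\<in>bounded_ops. P T \<in> M) \<and>
    (\<forall>A\<in>M. P A = A) \<and>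
    (\<forall>T\<in>bounded_ops. norm (P T) \<le> norm T)"

definition injective_vna :: "('h::complex_hilbert \<Rightarrow>\<^sub>L 'h) set \<Rightarrow> bool"
  where "injective_vna M \<longleftrightarrow> von_neumann_algebra M \<and> (\<exists>P. norm_one_projection M P)"

definition positive_map_on ::
  "('h::complex_hilbert \<Rightarrow>\<^sub>L 'h) set \<Rightarrow> (('h \<Rightarrow>\<^sub>L 'h) \<Rightarrow> 'h \<Rightarrow>\<^sub>L 'h) \<Rightarrow> bool"
  where "positive_map_on S \<Phi> \<longleftrightarrow>
    clinear_on S \<Phi> \<and> (\<forall>C\<in>S. positive_op C \<longrightarrow> positive_op (\<Phi> C))"

text \<open>
  An operator matrix \<open>(C\<^sub>i\<^sub>j)\<close> with \<open>i, j < n\<close> acts on \<open>H\<^sup>n\<close> by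
  \<open>(C \<xi>)\<^sub>i = (\<Sum>j<n. C\<^sub>i\<^sub>j \<xi>\<^sub>j)\<close>; the double sum below is the inner product of \<open>C \<xi>\<close> with \<open>\<xi>\<close>
  in \<open>H\<^sup>n\<close>.
\<close>

definition positive_op_matrix ::
  "nat \<Rightarrow> (nat \<Rightarrow> nat \<Rightarrow> 'h::complex_hilbert \<Rightarrow>\<^sub>L 'h) \<Rightarrow> bool"
  where "positive_op_matrix n C \<longleftrightarrow>
    (\<forall>i<n. \<forall>j<n. C i j \<in> bounded_ops) \<and>
    (\<forall>\<xi>. (\<Sum>i<n. cinner (\<Sum>j<n. blinfun_apply (C i j) (\<xi> j)) (\<xi> i)) \<in> \<real>\<^sub>\<ge>\<^sub>0)"

definition completely_positive_on ::
  "('h::complex_hilbert \<Rightarrow>\<^sub>L 'h) set \<Rightarrow> (('h \<Rightarrow>\<^sub>L 'h) \<Rightarrow> 'h \<Rightarrow>\<^sub>L 'h) \<Rightarrow> bool"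
  where "completely_positive_on S \<Phi> \<longleftrightarrow>
    clinear_on S \<Phi> \<and>
    (\<forall>n C. (\<forall>i<n. \<forall>j<n. C i j \<in> S) \<longrightarrow> positive_op_matrix n C \<longrightarrow>
      positive_op_matrix n (\<lambda>i j. \<Phi> (C i j)))"

end

theory Submission
  imports Defs
begin

text \<open>
  The tensor \<open>\<Sum> A\<^sub>i \<otimes> B\<^sub>i\<close> controls everything. Since \<open>E = \<langle>\<cdot>, x\<rangle> x\<close> and \<open>x\<close> is separating,
  \<open>C\<^sub>\<phi> = \<Sum> \<langle>\<cdot>, B\<^sub>i\<^sup>* x\<rangle> A\<^sub>i x\<close> determines the tensor, and when \<open>C\<^sub>\<phi> \<ge> 0\<close> a Cholesky elimination of this
  finite rank form, carried out inside the algebra, rewrites the tensor as \<open>\<Sum> V\<^sub>j\<^sup>* \<otimes> V\<^sub>j\<close>. This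
  gives (ii), (iii) and (iv) at once, and (iv) is handled by exchanging the roles of the factors of
  the tensor. Finally (i) implies (v): in a factor, the algebra and its commutant together act
  irreducibly, so the tuple \<open>(E V\<^sub>j y)\<^sub>j\<close> is a limit of tuples \<open>(\<Sum>\<^sub>q a\<^sub>q V\<^sub>j \<xi>\<^sub>q)\<^sub>j\<close> with \<open>a\<^sub>q\<close> in the
  algebra, for the operators \<open>V = (B\<^sub>i, A\<^sub>i\<^sup>*)\<close>, and complete positivity is tested on such tuples.
\<close>

section \<open>The inner product\<close>

lemma cinner_add_right: "cinner x (y + z) = cinner x y + cinner x (z::'h::complex_hilbert)"
  by (metis cinner_add_left cinner_commute complex_cnj_add)

lemma cinner_scaleC_right: "cinner x (c *\<^sub>C y) = cnj c * cinner x (y::'h::complex_hilbert)"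
  by (metis cinner_commute cinner_scaleC_left complex_cnj_mult)

text \<open>The Cauchy-Schwarz inequality, the parallelogram law, Pythagoras and the variational
  argument for projections are all read off from this expansion.\<close>

lemma power2_norm_add:
  "(norm (x + y))\<^sup>2 = (norm x)\<^sup>2 + (norm y)\<^sup>2 + 2 * Re (cinner x (y::'h::complex_hilbert))"
proof -
  have "complex_of_real ((norm (x + y))\<^sup>2)
      = cinner x x + cinner y y + (cinner x y + cnj (cinner x y))"
    by (metis (no_types, opaque_lifting) add.assoc add.commute cinner_add_left cinner_add_right
        cinner_commute cinner_self)
  also have "\<dots> = complex_of_real ((norm x)\<^sup>2 + (norm y)\<^sup>2 + 2 * Re (cinner x y))"
    by (simp add: cinner_self complex_add_cnj del: of_real_power)
  finally show ?thesis
    using of_real_eq_iff by blast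
qed

lemma scaleC_zero_right [simp]: "c *\<^sub>C (0::'h::complex_hilbert) = 0"
  by (metis bounded_linear_scaleC linear_simps(3))

lemma scaleC_zero_left [simp]: "0 *\<^sub>C (x::'h::complex_hilbert) = 0"
  using scaleC_of_real[of 0 x] by simp

lemma scaleC_one [simp]: "1 *\<^sub>C (x::'h::complex_hilbert) = x"
  using scaleC_of_real[of 1 x] by simp

lemma scaleC_minus_one [simp]: "(-1) *\<^sub>C (x::'h::complex_hilbert) = - x"
  using scaleC_of_real[of "-1" x] by simp

lemma scaleC_minus_left: "(- c) *\<^sub>C (x::'h::complex_hilbert) = - (c *\<^sub>C x)"
  using scaleC_add_left[of c "- c" x] by (simp add: eq_neg_iff_add_eq_0 add.commute)

lemma scaleC_minus_right: "c *\<^sub>C (x - y) = c *\<^sub>C x - c *\<^sub>C (y::'h::complex_hilbert)"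
  by (metis bounded_linear_scaleC linear_simps(2))

lemma scaleC_sum_right: "c *\<^sub>C (\<Sum>i\<in>I. f i) = (\<Sum>i\<in>I. c *\<^sub>C (f i :: 'h::complex_hilbert))"
  using bounded_linear_scaleC bounded_linear.linear linear_sum by blast

lemma scaleC_sum_left: "(\<Sum>i\<in>I. f i) *\<^sub>C (x::'h::complex_hilbert) = (\<Sum>i\<in>I. f i *\<^sub>C x)"
  by (induction I rule: infinite_finite_induct) (simp_all add: scaleC_add_left)

lemma cinner_zero_right [simp]: "cinner x (0::'h::complex_hilbert) = 0"
  using cinner_add_right[of x 0 0] by simp

lemma Cauchy_Schwarz_cinner: "cmod (cinner x y) \<le> norm x * norm (y::'h::complex_hilbert)"
proof (cases "y = 0")
  case False
  \<comment> \<open>This \<open>c\<close> makes \<open>x + c *\<^sub>C y\<close> the component of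
    \<open>x\<close> orthogonal to \<open>y\<close>; its squared norm is nonnegative, which is the
    inequality.\<close>
  define c where "c = - (cinner x y / complex_of_real ((norm y)\<^sup>2))"
  have ny: "(norm y)\<^sup>2 > 0"
    using False by simp
  have re: "Re (cnj c * cinner x y) = - ((cmod (cinner x y))\<^sup>2 / (norm y)\<^sup>2)"
    unfolding c_def cmod_power2 by (simp add: field_simps power2_eq_square flip: of_real_power)
  have "(cmod c * norm y)\<^sup>2 = (cmod (cinner x y))\<^sup>2 / (norm y)\<^sup>2"
    using ny unfolding c_def
    by (simp add: norm_divide norm_power norm_mult field_simps power2_eq_square)
  then have "(norm (x + c *\<^sub>C y))\<^sup>2 = (norm x)\<^sup>2 - (cmod (cinner x y))\<^sup>2 / (norm y)\<^sup>2"
    unfolding power2_norm_add norm_scaleC cinner_scaleC_right re by simp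
  then have "(cmod (cinner x y))\<^sup>2 / (norm y)\<^sup>2 \<le> (norm x)\<^sup>2"
    by (metis diff_ge_0_iff_ge zero_le_power2)
  then have "(cmod (cinner x y))\<^sup>2 \<le> (norm x * norm y)\<^sup>2"
    using ny by (simp add: pos_divide_le_eq power_mult_distrib)
  then show ?thesis
    by (rule power2_le_imp_le) simp
qed simp

interpretation cinner: bounded_bilinear "cinner :: 'h::complex_hilbert \<Rightarrow> 'h \<Rightarrow> complex"
proof
  show "\<exists>K. \<forall>a b::'h. cmod (cinner a b) \<le> norm a * norm b * K"
    using Cauchy_Schwarz_cinner by (intro exI[of _ 1]) auto
qed (simp_all add: cinner_add_left cinner_add_right cinner_scaleC_left cinner_scaleC_right
    scaleR_conv_of_real flip: scaleC_of_real)

lemma cinner_eq_zero_iff [simp]: "cinner x x = 0 \<longleftrightarrow> x = (0::'h::complex_hilbert)"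
  by (simp add: cinner_self)

lemma cinner_right_ext: "(\<And>v. cinner v x = cinner v y) \<Longrightarrow> x = (y::'h::complex_hilbert)"
  using cinner_eq_zero_iff[of "x - y"] by (simp add: cinner.diff_right)


section \<open>Orthogonal projection in spaces of tuples\<close>

text \<open>
  The Hilbert space \<open>H\<^sup>m\<close> is represented by functions \<open>nat \<Rightarrow> 'h\<close> of which only the values
  below \<open>m\<close> matter.
\<close>

locale tuple_subspace =
  fixes m :: nat and K :: "(nat \<Rightarrow> 'h::complex_hilbert) set"
  assumes zero_mem: "(\<lambda>i. 0) \<in> K"
    and add_mem: "\<And>u v. u \<in> K \<Longrightarrow> v \<in> K \<Longrightarrow> (\<lambda>i. u i + v i) \<in> K"
    and scaleC_mem: "\<And>c u. u \<in> K \<Longrightarrow> (\<lambda>i. c *\<^sub>C u i) \<in> K"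
begin

text \<open>The norm closure in H^m, expressed by sequences: convergence of each coordinate below
  \<open>m\<close> amounts to convergence in H^m.\<close>

definition in_closure :: "(nat \<Rightarrow> 'h) \<Rightarrow> bool"
  where "in_closure p \<longleftrightarrow> (\<exists>u. (\<forall>n. u n \<in> K) \<and> (\<forall>i<m. (\<lambda>n::nat. u n i) \<longlonglongrightarrow> p i))"

text \<open>The orthogonal projection onto the closure of \<open>K\<close>, as a relation:
  \<open>p\<close> is determined only in its coordinates below \<open>m\<close>.\<close>

definition is_proj :: "(nat \<Rightarrow> 'h) \<Rightarrow> (nat \<Rightarrow> 'h) \<Rightarrow> bool"
  where "is_proj z p \<longleftrightarrow>
    in_closure p \<and> (\<forall>w\<in>K. (\<Sum>i<m. cinner (z i - p i) (w i)) = 0)"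

text \<open>A sequence in \<open>K\<close> minimizing the distance to \<open>z\<close> is Cauchy by
  the parallelogram law, so it converges by completeness of H. Minimality of the limit forces
  orthogonality.\<close>

lemma is_proj_exists: "\<exists>p. is_proj z p"
proof -
  define sq where "sq w = (\<Sum>i<m. (norm (w i))\<^sup>2)" for w :: "nat \<Rightarrow> 'h"
  define d where "d = (INF u\<in>K. sq (\<lambda>i. z i - u i))"
  have sq_nonneg: "sq w \<ge> 0" for w
    unfolding sq_def by (simp add: sum_nonneg)
  have bdd: "bdd_below ((\<lambda>u. sq (\<lambda>i. z i - u i)) ` K)"
    using sq_nonneg by (intro bdd_belowI2)
  have d_le: "d \<le> sq (\<lambda>i. z i - u i)" if "u \<in> K" for u
    unfolding d_def using bdd that by (rule cINF_lower)
  have "\<exists>u\<in>K. sq (\<lambda>i. z i - u i) < d + 1 / Suc n" for n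
    using cINF_less_iff[OF _ bdd, of "d + 1 / Suc n"] zero_mem
    unfolding d_def by auto
  then obtain u where u: "\<And>n. u n \<in> K" and u_less: "\<And>n. sq (\<lambda>i. z i - u n i) < d + 1 / Suc n"
    by metis
  have par: "sq (\<lambda>i. u n i - u l i) \<le> 2 / Suc n + 2 / Suc l" for n l
  proof -
    \<comment> \<open>The midpoint of two approximants lies in \<open>K\<close>, so its distance to
      \<open>z\<close> is at least the infimum; this bounds how far apart they can be.\<close>
    define c where "c i = (1/2) *\<^sub>C (u n i + u l i)" for i
    have c: "c \<in> K"
      unfolding c_def by (intro scaleC_mem add_mem u)
    have "(norm (u n i - u l i))\<^sup>2 = 2 * (norm (z i - u n i))\<^sup>2 + 2 * (norm (z i - u l i))\<^sup>2
        - 4 * (norm (z i - c i))\<^sup>2" for i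
    proof -
      have par0: "(norm (a + b))\<^sup>2 + (norm (a - b))\<^sup>2 = 2 * (norm a)\<^sup>2 + 2 * (norm b)\<^sup>2" for a b :: 'h
        using power2_norm_add[of a b] power2_norm_add[of a "- b"] by (simp add: cinner.minus_right)
      have "(1/2) *\<^sub>C v = (1/2) *\<^sub>R v" for v :: 'h
        using scaleC_of_real[of "1/2" v] by simp
      then have "(z i - u l i) + (z i - u n i) = 2 *\<^sub>R (z i - c i)"
        by (simp add: c_def algebra_simps scaleR_2)
      then have "(norm ((z i - u l i) + (z i - u n i)))\<^sup>2 = 4 * (norm (z i - c i))\<^sup>2"
        by (simp add: power_mult_distrib)
      then show ?thesis
        using par0[of "z i - u l i" "z i - u n i"] by simp
    qed
    then have "sq (\<lambda>i. u n i - u l i) = 2 * sq (\<lambda>i. z i - u n i) + 2 * sq (\<lambda>i. z i - u l i)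
        - 4 * sq (\<lambda>i. z i - c i)"
      unfolding sq_def by (simp add: sum.distrib sum_subtractf sum_distrib_left)
    with u_less[of n] u_less[of l] d_le[OF c] show ?thesis
      by simp
  qed
  have "convergent (\<lambda>n. u n i)" if "i < m" for i
  proof -
    have "Cauchy (\<lambda>n. u n i)"
    proof (rule CauchyI)
      fix e :: real
      assume "e > 0"
      then obtain N where N: "4 / Suc N < e\<^sup>2"
        using reals_Archimedean[of "e\<^sup>2 / 4"] by (auto simp: field_simps)
      have "norm (u n i - u l i) < e" if "n \<ge> N" "l \<ge> N" for n l
      proof -
        have "(norm (u n i - u l i))\<^sup>2 \<le> sq (\<lambda>i. u n i - u l i)"
          unfolding sq_def using \<open>i < m\<close> by (intro member_le_sum) auto
        also have "\<dots> \<le> 2 / Suc n + 2 / Suc l"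
          by (rule par)
        also have "\<dots> \<le> 2 / Suc N + 2 / Suc N"
          using that by (intro add_mono divide_left_mono) auto
        also have "\<dots> < e\<^sup>2"
          using N by simp
        finally show ?thesis
          using \<open>e > 0\<close> by (simp add: power_less_imp_less_base)
      qed
      then show "\<exists>N. \<forall>n\<ge>N. \<forall>l\<ge>N. norm (u n i - u l i) < e"
        by blast
    qed
    then show ?thesis
      by (simp add: Cauchy_convergent)
  qed
  then obtain p where p: "\<And>i. i < m \<Longrightarrow> (\<lambda>n. u n i) \<longlonglongrightarrow> p i"
    unfolding convergent_def by metis
  have sq_lim: "(\<lambda>n. sq (\<lambda>i. z i - u n i - w i)) \<longlonglongrightarrow> sq (\<lambda>i. z i - p i - w i)" for w
    unfolding sq_def by (intro tendsto_intros p) auto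
  have "(\<lambda>n. d + 1 / Suc n) \<longlonglongrightarrow> d + 0"
    by (intro tendsto_intros LIMSEQ_Suc lim_1_over_n)
  then have sq_p: "sq (\<lambda>i. z i - p i) \<le> d"
    using sq_lim[of "\<lambda>i. 0"] u_less by (intro LIMSEQ_le) (auto intro: less_imp_le)
  have "(\<Sum>i<m. cinner (z i - p i) (w i)) = 0" if w: "w \<in> K" for w
  proof -
    define g where "g = (\<Sum>i<m. cinner (z i - p i) (w i))"
    \<comment> \<open>Moving each \<open>u n\<close> by \<open>c w\<close> stays in
      \<open>K\<close>; in the limit, \<open>p + c w\<close> is no closer to \<open>z\<close> than
      \<open>p\<close> is.\<close>
    have ineq: "0 \<le> (cmod c)\<^sup>2 * sq w - 2 * Re (cnj c * g)" for c
    proof -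
      have "d \<le> sq (\<lambda>i. z i - u n i - c *\<^sub>C w i)" for n
        using d_le[OF add_mem[OF u[of n] scaleC_mem[OF w, of c]]] by (simp add: algebra_simps)
      then have "d \<le> sq (\<lambda>i. z i - p i - c *\<^sub>C w i)"
        using sq_lim[of "\<lambda>i. c *\<^sub>C w i"] by (intro LIMSEQ_le_const) auto
      also have "\<dots> = sq (\<lambda>i. z i - p i) + (cmod c)\<^sup>2 * sq w - 2 * Re (cnj c * g)"
      proof -
        have "(norm (z i - p i - c *\<^sub>C w i))\<^sup>2 = (norm (z i - p i))\<^sup>2 + (cmod c)\<^sup>2 * (norm (w i))\<^sup>2
            - 2 * Re (cnj c * cinner (z i - p i) (w i))" for i
          using power2_norm_add[of "z i - p i" "- (c *\<^sub>C w i)"]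
          by (simp add: cinner.minus_right cinner_scaleC_right norm_scaleC power_mult_distrib)
        then show ?thesis
          unfolding sq_def g_def
          by (simp add: sum.distrib sum_subtractf sum_distrib_left)
      qed
      finally show ?thesis
        using sq_p by simp
    qed
    show "g = 0"
    proof (rule ccontr)
      assume "g \<noteq> 0"
      then have g2: "(cmod g)\<^sup>2 > 0"
        by simp
      \<comment> \<open>With the multiple \<open>t g\<close> of \<open>w\<close> the quadratic term
        is dominated by the linear one, since \<open>t * sq w < 2\<close>; the \<open>+ 1\<close>
        covers \<open>sq w = 0\<close>.\<close>
      define t where "t = 1 / (sq w + 1)"
      have "Re (cnj (complex_of_real t * g) * g) = t * (cmod g)\<^sup>2"
        unfolding cmod_power2 by (simp add: algebra_simps power2_eq_square)
      then have "0 \<le> t\<^sup>2 * (cmod g)\<^sup>2 * sq w - 2 * (t * (cmod g)\<^sup>2)"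
        using ineq[of "complex_of_real t * g"] by (simp add: norm_mult power_mult_distrib)
      then have "0 \<le> (t * (cmod g)\<^sup>2) * (t * sq w - 2)"
        by (simp add: algebra_simps power2_eq_square)
      moreover have "t > 0" "t * sq w < 2"
        using sq_nonneg[of w] unfolding t_def by (auto simp: field_simps)
      ultimately show False
        using g2 by (smt (verit) mult_pos_neg mult_pos_pos)
    qed
  qed
  then show ?thesis
    unfolding is_proj_def in_closure_def using u p by blast
qed

section \<open>Stability of the closure, uniqueness and linearity of the projection\<close>

lemma in_closure_add:
  assumes "in_closure p" "in_closure q"
  shows "in_closure (\<lambda>i. p i + q i)"
proof -
  obtain u v where "\<forall>n. u n \<in> K" "\<forall>i<m. (\<lambda>n. u n i) \<longlonglongrightarrow> p i"
      "\<forall>n. v n \<in> K" "\<forall>i<m. (\<lambda>n. v n i) \<longlonglongrightarrow> q i"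
    using assms unfolding in_closure_def by blast
  then show ?thesis
    unfolding in_closure_def
    by (intro exI[of _ "\<lambda>n i. u n i + v n i"]) (auto intro: add_mem tendsto_add)
qed

lemma in_closure_image:
  assumes "in_closure p" and S: "\<And>u. u \<in> K \<Longrightarrow> (\<lambda>i. blinfun_apply S (u i)) \<in> K"
  shows "in_closure (\<lambda>i. blinfun_apply S (p i))"
proof -
  obtain u where "\<forall>n. u n \<in> K" "\<forall>i<m. (\<lambda>n. u n i) \<longlonglongrightarrow> p i"
    using assms unfolding in_closure_def by blast
  then show ?thesis
    unfolding in_closure_def
    by (intro exI[of _ "\<lambda>n i. blinfun_apply S (u n i)"]) (auto intro: S tendsto_intros)
qed

lemma in_closure_scaleC: "in_closure p \<Longrightarrow> in_closure (\<lambda>i. c *\<^sub>C p i)"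
  using in_closure_image[of p "scalar_op c"] scaleC_mem by (simp add: scalar_op.rep_eq)

lemma orthogonal_closure:
  assumes "\<And>w. w \<in> K \<Longrightarrow> (\<Sum>i<m. cinner (v i) (w i)) = 0" and "in_closure p"
  shows "(\<Sum>i<m. cinner (v i) (p i)) = 0"
proof -
  obtain u where u: "\<forall>n. u n \<in> K" "\<forall>i<m. (\<lambda>n. u n i) \<longlonglongrightarrow> p i"
    using assms unfolding in_closure_def by blast
  then have "(\<lambda>n. \<Sum>i<m. cinner (v i) (u n i)) \<longlonglongrightarrow> (\<Sum>i<m. cinner (v i) (p i))"
    by (intro tendsto_sum cinner.tendsto) auto
  moreover have "(\<Sum>i<m. cinner (v i) (u n i)) = 0" for n
    using u assms by blast
  ultimately show ?thesis
    by (simp add: LIMSEQ_const_iff)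
qed

text \<open>The difference of the two projections lies in the closure and is orthogonal to it, hence
  to itself. Agreement of \<open>z\<close> and \<open>z'\<close> is asked only below
  \<open>m\<close>, so that differently written tuples can be compared.\<close>

lemma is_proj_unique:
  assumes "is_proj z p" "is_proj z' p'" and eq: "\<And>i. i < m \<Longrightarrow> z i = z' i" and "i < m"
  shows "p i = p' i"
proof -
  let ?v = "\<lambda>i. p i + (-1) *\<^sub>C p' i"
  have cl: "in_closure ?v"
    using assms unfolding is_proj_def by (intro in_closure_add in_closure_scaleC) auto
  have "(\<Sum>i<m. cinner (?v i) (w i)) = 0" if "w \<in> K" for w
  proof -
    have "(\<Sum>i<m. cinner (?v i) (w i))
        = (\<Sum>i<m. cinner (z' i - p' i) (w i)) - (\<Sum>i<m. cinner (z i - p i) (w i))"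
      using eq by (simp add: cinner.diff_left cinner.add_left cinner.minus_left flip: sum_subtractf)
    also have "\<dots> = 0"
      using assms that by (simp add: is_proj_def)
    finally show ?thesis .
  qed
  then have "(\<Sum>i<m. cinner (?v i) (?v i)) = 0"
    using cl by (rule orthogonal_closure)
  then have "complex_of_real (\<Sum>i<m. (norm (?v i))\<^sup>2) = 0"
    by (simp add: cinner_self)
  then have "(\<Sum>i<m. (norm (?v i))\<^sup>2) = 0"
    using of_real_eq_0_iff by blast
  then have "\<forall>i\<in>{..<m}. (norm (?v i))\<^sup>2 = 0"
    by (subst (asm) sum_nonneg_eq_0_iff) auto
  then show ?thesis
    using \<open>i < m\<close> by simp
qed

lemma is_proj_add:
  assumes "is_proj z p" "is_proj z' p'"
  shows "is_proj (\<lambda>i. z i + z' i) (\<lambda>i. p i + p' i)"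
  using assms unfolding is_proj_def
  by (auto intro: in_closure_add simp: add_diff_add cinner.add_left sum.distrib)

lemma is_proj_scaleC: "is_proj z p \<Longrightarrow> is_proj (\<lambda>i. c *\<^sub>C z i) (\<lambda>i. c *\<^sub>C p i)"
  unfolding is_proj_def
  by (auto intro: in_closure_scaleC
      simp: cinner_scaleC_left scaleC_minus_right[symmetric] sum_distrib_left[symmetric])

lemma is_proj_self: "z \<in> K \<Longrightarrow> is_proj z z"
  unfolding is_proj_def in_closure_def by (auto simp: cinner.zero_left)

lemma is_proj_sum:
  "finite I \<Longrightarrow> (\<And>j. j \<in> I \<Longrightarrow> is_proj (z j) (p j)) \<Longrightarrow>
    is_proj (\<lambda>i. \<Sum>j\<in>I. z j i) (\<lambda>i. \<Sum>j\<in>I. p j i)"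
  by (induction I rule: finite_induct) (auto intro: is_proj_add is_proj_self zero_mem)

text \<open>Pythagoras. It bounds the matrix entries of the projection, which makes them bounded
  operators.\<close>

lemma is_proj_norm_le:
  assumes "is_proj z p" "i < m"
  shows "(norm (p i))\<^sup>2 \<le> (\<Sum>i<m. (norm (z i))\<^sup>2)"
proof -
  have "(\<Sum>i<m. cinner (z i - p i) (p i)) = 0"
    using assms orthogonal_closure[of "\<lambda>i. z i - p i" p] unfolding is_proj_def by auto
  then have orth: "(\<Sum>i<m. Re (cinner (z i - p i) (p i))) = 0"
    by (metis Re_sum zero_complex.sel(1))
  have "(norm (z i))\<^sup>2 = (norm (z i - p i))\<^sup>2 + (norm (p i))\<^sup>2 + 2 * Re (cinner (z i - p i) (p i))" for i
    using power2_norm_add[of "z i - p i" "p i"] by simp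
  then have "(\<Sum>i<m. (norm (z i))\<^sup>2)
      = (\<Sum>i<m. (norm (z i - p i))\<^sup>2) + (\<Sum>i<m. (norm (p i))\<^sup>2)"
    using orth by (simp add: sum.distrib flip: sum_distrib_left)
  moreover have "(norm (p i))\<^sup>2 \<le> (\<Sum>i<m. (norm (p i))\<^sup>2)"
    using \<open>i < m\<close> by (intro member_le_sum) auto
  ultimately show ?thesis
    by (smt (verit) sum_nonneg zero_le_power2)
qed

end


section \<open>Adjoints\<close>

lemma bounded_opsD: "T \<in> bounded_ops \<Longrightarrow> blinfun_apply T (c *\<^sub>C v) = c *\<^sub>C blinfun_apply T v"
  by (simp add: bounded_ops_def)

text \<open>For \<open>m = 1\<close> the tuple projection is the ordinary one. Removing from
  \<open>v0\<close> its projection onto the kernel of \<open>f\<close> leaves \<open>w\<close>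
  orthogonal to the kernel, and a multiple of \<open>w\<close> represents \<open>f\<close>.\<close>

lemma Riesz_representation:
  fixes f :: "'h::complex_hilbert \<Rightarrow> complex"
  assumes bl: "bounded_linear f" and hom: "\<And>c v. f (c *\<^sub>C v) = c * f v"
  obtains r where "\<And>v. f v = cinner v r"
proof (cases "\<forall>v. f v = 0")
  case True
  then show ?thesis
    using that[of 0] by simp
next
  case False
  then obtain v0 where v0: "f v0 \<noteq> 0"
    by blast
  interpret bounded_linear f
    by (rule bl)
  interpret tuple_subspace 1 "{u. f (u 0) = 0}"
    by standard (auto simp: zero add hom)
  obtain p where p: "is_proj (\<lambda>i. v0) p"
    using is_proj_exists by blast
  then obtain u where u: "\<And>n. f (u n 0) = 0" "(\<lambda>n. u n (0::nat)) \<longlonglongrightarrow> p 0"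
    unfolding is_proj_def in_closure_def by auto
  have "(\<lambda>n. f (u n 0)) \<longlonglongrightarrow> f (p 0)"
    by (rule tendsto[OF u(2)])
  then have "f (p 0) = 0"
    using u(1) by (simp add: LIMSEQ_const_iff)
  define w where "w = v0 - p 0"
  have fw: "f w \<noteq> 0"
    unfolding w_def using v0 \<open>f (p 0) = 0\<close> by (simp add: diff)
  then have "w \<noteq> 0"
    using zero by auto
  have orth: "cinner w v = 0" if "f v = 0" for v
    using p that unfolding is_proj_def w_def
    by (auto dest!: bspec[of _ _ "\<lambda>i. v"])
  define r where "r = cnj (f w / cinner w w) *\<^sub>C w"
  have "f v = cinner v r" for v
  proof -
    have "f (f v *\<^sub>C w - f w *\<^sub>C v) = 0"
      by (simp add: diff hom)
    then have "cinner (f v *\<^sub>C w - f w *\<^sub>C v) w = 0"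
      using orth cinner_commute by (metis complex_cnj_zero)
    then have "f v * cinner w w = f w * cinner v w"
      by (simp add: cinner.diff_left cinner_scaleC_left)
    then show ?thesis
      unfolding r_def cinner_scaleC_right using \<open>w \<noteq> 0\<close> by (simp add: field_simps)
  qed
  then show ?thesis
    using that by blast
qed

text \<open>Riesz gives the adjoint pointwise as \<open>s y\<close>; testing the identity at
  \<open>s y\<close> itself bounds its norm. With uniqueness, this gives meaning to the definite
  description in \<open>adj\<close>.\<close>

lemma adj_exists:
  assumes T: "T \<in> bounded_ops"
  shows "\<exists>!S. \<forall>x y. cinner (blinfun_apply T x) y = cinner x (blinfun_apply S y)"
proof -
  have "\<exists>r. \<forall>v. cinner (blinfun_apply T v) y = cinner v r" for y
  proof (rule Riesz_representation[of "\<lambda>v. cinner (blinfun_apply T v) y"])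
    show "bounded_linear (\<lambda>v. cinner (blinfun_apply T v) y)"
      using blinfun.bounded_linear_right cinner.bounded_linear_left bounded_linear_compose by blast
    show "cinner (blinfun_apply T (c *\<^sub>C v)) y = c * cinner (blinfun_apply T v) y" for c v
      using T by (simp add: bounded_opsD cinner_scaleC_left)
  qed blast
  then obtain s where s: "\<And>y v. cinner (blinfun_apply T v) y = cinner v (s y)"
    by metis
  have "bounded_linear s"
  proof (rule bounded_linear_intro[where K = "norm T"])
    show "s (x + y) = s x + s y" for x y
      by (rule cinner_right_ext) (simp add: cinner.add_right flip: s)
    show "s (r *\<^sub>R x) = r *\<^sub>R s x" for r x
      by (rule cinner_right_ext) (simp add: cinner.scaleR_right flip: s)
    show "norm (s y) \<le> norm y * norm T" for y
    proof (cases "s y = 0")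
      case False
      have "(norm (s y))\<^sup>2 = cmod (cinner (blinfun_apply T (s y)) y)"
        unfolding s by (simp add: cinner_self norm_power)
      also have "\<dots> \<le> norm (blinfun_apply T (s y)) * norm y"
        by (rule Cauchy_Schwarz_cinner)
      also have "\<dots> \<le> norm T * norm (s y) * norm y"
        by (intro mult_right_mono norm_blinfun) auto
      finally show ?thesis
        using False by (simp add: power2_eq_square mult.commute mult.left_commute)
    qed simp
  qed
  then have "\<forall>x y. cinner (blinfun_apply T x) y = cinner x (blinfun_apply (Blinfun s) y)"
    using s by (simp add: bounded_linear_Blinfun_apply)
  moreover have "S = S'" if "\<forall>x y. cinner (blinfun_apply T x) y = cinner x (blinfun_apply S y)"
    "\<forall>x y. cinner (blinfun_apply T x) y = cinner x (blinfun_apply S' y)" for S S'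
    by (rule blinfun_eqI, rule cinner_right_ext) (metis that)
  ultimately show ?thesis
    by blast
qed

lemma cinner_adj:
  assumes "T \<in> bounded_ops"
  shows "cinner (blinfun_apply T x) y = cinner x (blinfun_apply (adj T) y)"
  using theI'[OF adj_exists[OF assms]] unfolding adj_def by blast

lemma cinner_adj':
  assumes "T \<in> bounded_ops"
  shows "cinner (blinfun_apply (adj T) x) y = cinner x (blinfun_apply T y)"
  by (metis assms cinner_adj cinner_commute)

lemma adj_unique:
  assumes "T \<in> bounded_ops"
    and "\<And>x y. cinner (blinfun_apply T x) y = cinner x (blinfun_apply S y)"
  shows "adj T = S"
  using assms adj_exists[OF assms(1)] cinner_adj[OF assms(1)] by blast

lemma adj_in_bounded_ops:
  assumes "T \<in> bounded_ops"
  shows "adj T \<in> bounded_ops"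
proof -
  have "blinfun_apply (adj T) (c *\<^sub>C y) = c *\<^sub>C blinfun_apply (adj T) y" for c y
    by (rule cinner_right_ext) (simp add: cinner_scaleC_right assms flip: cinner_adj)
  then show ?thesis
    by (simp add: bounded_ops_def)
qed

lemma adj_adj: "T \<in> bounded_ops \<Longrightarrow> adj (adj T) = T"
  by (intro adj_unique adj_in_bounded_ops cinner_adj')

lemma bounded_opsI: "(\<And>c v. blinfun_apply T (c *\<^sub>C v) = c *\<^sub>C blinfun_apply T v) \<Longrightarrow> T \<in> bounded_ops"
  by (simp add: bounded_ops_def)

lemma compose_in_bounded_ops:
  "S \<in> bounded_ops \<Longrightarrow> T \<in> bounded_ops \<Longrightarrow> S o\<^sub>L T \<in> bounded_ops"
  by (rule bounded_opsI) (simp add: bounded_opsD)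

lemma adj_compose:
  "S \<in> bounded_ops \<Longrightarrow> T \<in> bounded_ops \<Longrightarrow> adj (S o\<^sub>L T) = adj T o\<^sub>L adj S"
  by (rule adj_unique) (simp_all add: compose_in_bounded_ops cinner_adj)

section \<open>Algebra of operators\<close>

abbreviation scale_op :: "complex \<Rightarrow> ('h::complex_hilbert \<Rightarrow>\<^sub>L 'h) \<Rightarrow> 'h \<Rightarrow>\<^sub>L 'h"
    (infixr "*\<^sub>O" 75)
  where "c *\<^sub>O T \<equiv> scalar_op c o\<^sub>L T"

lemma scale_op_apply [simp]: "blinfun_apply (scalar_op c) v = c *\<^sub>C v"
  by (simp add: scalar_op.rep_eq)

lemma scale_op_in_bounded_ops: "T \<in> bounded_ops \<Longrightarrow> c *\<^sub>O T \<in> bounded_ops"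
  by (rule bounded_opsI) (simp add: bounded_opsD scaleC_scaleC mult.commute)

lemma add_in_bounded_ops: "S \<in> bounded_ops \<Longrightarrow> T \<in> bounded_ops \<Longrightarrow> S + T \<in> bounded_ops"
  by (rule bounded_opsI) (simp add: blinfun.add_left bounded_opsD scaleC_add_right)

lemma zero_in_bounded_ops: "0 \<in> bounded_ops"
  by (rule bounded_opsI) simp

lemma sum_in_bounded_ops: "(\<And>i. i \<in> I \<Longrightarrow> T i \<in> bounded_ops) \<Longrightarrow> sum T I \<in> bounded_ops"
  by (induction I rule: infinite_finite_induct) (auto intro: add_in_bounded_ops zero_in_bounded_ops)

lemma scale_op_sum: "c *\<^sub>O (\<Sum>i\<in>I. T i) = (\<Sum>i\<in>I. c *\<^sub>O T i)"
  by (rule blinfun_eqI) (simp add: blinfun.sum_left scaleC_sum_right)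

lemma scale_op_scale_op: "c *\<^sub>O d *\<^sub>O T = (c * d) *\<^sub>O T"
  by (rule blinfun_eqI) (simp add: scaleC_scaleC)

lemma scale_op_compose: "c *\<^sub>O (S o\<^sub>L T) = (c *\<^sub>O S) o\<^sub>L T"
  by (rule blinfun_eqI) simp

lemma compose_scale_op: "S \<in> bounded_ops \<Longrightarrow> S o\<^sub>L (c *\<^sub>O T) = c *\<^sub>O (S o\<^sub>L T)"
  by (rule blinfun_eqI) (simp add: bounded_opsD)

lemma add_compose: "(S + S') o\<^sub>L T = (S o\<^sub>L T) + (S' o\<^sub>L T)"
  by (rule blinfun_eqI) (simp add: blinfun.add_left)

lemma compose_add: "S o\<^sub>L (T + T') = (S o\<^sub>L T) + (S o\<^sub>L T')"
  by (rule blinfun_eqI) (simp add: blinfun.add_left blinfun.add_right)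

lemma adj_scale_op:
  assumes "T \<in> bounded_ops"
  shows "adj (c *\<^sub>O T) = cnj c *\<^sub>O adj T"
  by (rule adj_unique)
    (simp_all add: assms scale_op_in_bounded_ops cinner_adj cinner_scaleC_left cinner_scaleC_right)

section \<open>Closure properties of a von Neumann algebra and of its commutant\<close>

lemma vna_facts:
  assumes "von_neumann_algebra M"
  shows vna_bounded: "A \<in> M \<Longrightarrow> A \<in> bounded_ops"
    and vna_add: "A \<in> M \<Longrightarrow> B \<in> M \<Longrightarrow> A + B \<in> M"
    and vna_scale: "A \<in> M \<Longrightarrow> c *\<^sub>O A \<in> M"
    and vna_compose: "A \<in> M \<Longrightarrow> B \<in> M \<Longrightarrow> A o\<^sub>L B \<in> M"
    and vna_adj: "A \<in> M \<Longrightarrow> adj A \<in> M"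
    and vna_bicommutant: "commutant (commutant M) = M"
  using assms unfolding von_neumann_algebra_def by auto

text \<open>Scalars commute with every complex linear operator, so they lie in the double commutant,
  which is \<open>M\<close>. The identity of \<open>M\<close> comes from here.\<close>

lemma vna_scalar: "von_neumann_algebra M \<Longrightarrow> scalar_op c \<in> M"
  by (subst vna_bicommutant[symmetric], assumption)
    (auto simp: commutant_def scaleC_scaleC mult.commute bounded_opsD
      intro!: bounded_opsI blinfun_eqI)

lemma vna_zero: "von_neumann_algebra M \<Longrightarrow> 0 \<in> M"
  using vna_scalar[of M 0] by (metis (no_types, lifting) blinfun.zero_left blinfun_eqI
      scale_op_apply scaleC_zero_left)

lemma vna_one: "von_neumann_algebra M \<Longrightarrow> id_blinfun \<in> M"
  using vna_scalar[of M 1] by (metis (no_types, lifting) blinfun_eqI id_blinfun.rep_eq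
      scale_op_apply scaleC_one id_apply)

lemma vna_sum:
  "von_neumann_algebra M \<Longrightarrow> (\<And>i. i \<in> I \<Longrightarrow> A i \<in> M) \<Longrightarrow> sum A I \<in> M"
  by (induction I rule: infinite_finite_induct) (auto intro: vna_add vna_zero)

text \<open>Take adjoints in the commutation of \<open>T\<close> with \<open>adj A\<close>, which
  again lies in \<open>M\<close>.\<close>

lemma commutant_adj:
  assumes M: "von_neumann_algebra M" and T: "T \<in> commutant M"
  shows "adj T \<in> commutant M"
proof -
  have bT: "T \<in> bounded_ops"
    using T by (simp add: commutant_def)
  have "adj T o\<^sub>L A = A o\<^sub>L adj T" if A: "A \<in> M" for A
  proof -
    have bA: "A \<in> bounded_ops" "adj A \<in> bounded_ops"
      using vna_bounded[OF M A] by (auto intro: adj_in_bounded_ops)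
    have "adj (adj A o\<^sub>L T) = adj (T o\<^sub>L adj A)"
      using T vna_adj[OF M A] by (simp add: commutant_def)
    then show ?thesis
      using bT bA by (simp add: adj_compose adj_adj)
  qed
  then show ?thesis
    using bT by (simp add: commutant_def adj_in_bounded_ops)
qed


section \<open>A density theorem for factors\<close>

text \<open>The tuples generated from all \<open>(V j v)\<close>, indexed by \<open>j\<close>, under
  the diagonal action of \<open>M\<close>. Finite sums are encoded as lists of pairs, so that
  addition is concatenation.\<close>

definition amplified_span ::
    "('h::complex_hilbert \<Rightarrow>\<^sub>L 'h) set \<Rightarrow> (nat \<Rightarrow> 'h \<Rightarrow>\<^sub>L 'h) \<Rightarrow> (nat \<Rightarrow> 'h) set"
  where "amplified_span M V =
    {\<lambda>j. \<Sum>(a, v)\<leftarrow>xs. blinfun_apply a (blinfun_apply (V j) v) | xs. set xs \<subseteq> M \<times> UNIV}"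

lemma tuple_subspace_amplified_span:
  assumes M: "von_neumann_algebra M"
  shows "tuple_subspace (amplified_span M V)"
proof
  show "(\<lambda>i. 0) \<in> amplified_span M V"
    unfolding amplified_span_def by (auto intro!: exI[of _ "[]"])
next
  fix z w
  assume "z \<in> amplified_span M V" "w \<in> amplified_span M V"
  then obtain xs ys where "set xs \<subseteq> M \<times> UNIV" "set ys \<subseteq> M \<times> UNIV"
    "z = (\<lambda>j. \<Sum>(a, v)\<leftarrow>xs. blinfun_apply a (blinfun_apply (V j) v))"
    "w = (\<lambda>j. \<Sum>(a, v)\<leftarrow>ys. blinfun_apply a (blinfun_apply (V j) v))"
    unfolding amplified_span_def by blast
  then show "(\<lambda>i. z i + w i) \<in> amplified_span M V"
    unfolding amplified_span_def by (auto intro!: exI[of _ "xs @ ys"])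
next
  fix c z
  assume "z \<in> amplified_span M V"
  then obtain xs where xs: "set xs \<subseteq> M \<times> UNIV"
    and z: "z = (\<lambda>j. \<Sum>(a, v)\<leftarrow>xs. blinfun_apply a (blinfun_apply (V j) v))"
    unfolding amplified_span_def by blast
  have "c *\<^sub>C (\<Sum>(a, v)\<leftarrow>xs. blinfun_apply a (blinfun_apply (V j) v))
      = (\<Sum>(a, v)\<leftarrow>map (\<lambda>(a, v). (c *\<^sub>O a, v)) xs. blinfun_apply a (blinfun_apply (V j) v))" for j
    by (induction xs) (auto simp: scaleC_add_right)
  then show "(\<lambda>i. c *\<^sub>C z i) \<in> amplified_span M V"
    unfolding amplified_span_def z using xs
    by (auto intro!: exI[of _ "map (\<lambda>(a, v). (c *\<^sub>O a, v)) xs"] vna_scale[OF M])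
qed

text \<open>An element of \<open>M\<close> is absorbed into the coefficients \<open>a\<close>. An
  element of the commutant passes through \<open>a\<close> and, as \<open>V j\<close> is in
  \<open>M\<close>, through \<open>V j\<close>, and is absorbed into the vectors.\<close>

lemma amplified_span_invariant:
  assumes M: "von_neumann_algebra M" and V: "\<And>j. V j \<in> M"
    and S: "S \<in> M \<or> S \<in> commutant M" and z: "z \<in> amplified_span M V"
  shows "(\<lambda>j. blinfun_apply S (z j)) \<in> amplified_span M V"
proof -
  obtain xs where xs: "set xs \<subseteq> M \<times> UNIV"
    and z_eq: "z = (\<lambda>j. \<Sum>(a, v)\<leftarrow>xs. blinfun_apply a (blinfun_apply (V j) v))"
    using z unfolding amplified_span_def by blast
  from S show ?thesis
  proof
    assume "S \<in> M"
    have "blinfun_apply S (\<Sum>(a, v)\<leftarrow>xs. blinfun_apply a (blinfun_apply (V j) v))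
      = (\<Sum>(a, v)\<leftarrow>map (\<lambda>(a, v). (S o\<^sub>L a, v)) xs. blinfun_apply a (blinfun_apply (V j) v))" for j
      by (induction xs) (auto simp: blinfun.add_right)
    then show ?thesis
      unfolding amplified_span_def z_eq using xs \<open>S \<in> M\<close>
      by (auto intro!: exI[of _ "map (\<lambda>(a, v). (S o\<^sub>L a, v)) xs"] vna_compose[OF M])
  next
    assume "S \<in> commutant M"
    then have comm: "blinfun_apply S (blinfun_apply a v) = blinfun_apply a (blinfun_apply S v)"
      if "a \<in> M" for a v
    proof -
      have "S o\<^sub>L a = a o\<^sub>L S"
        using \<open>S \<in> commutant M\<close> that by (simp add: commutant_def)
      then show ?thesis
        by (metis blinfun_apply_blinfun_compose)
    qed
    have "blinfun_apply S (\<Sum>(a, v)\<leftarrow>xs. blinfun_apply a (blinfun_apply (V j) v))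
      = (\<Sum>(a, v)\<leftarrow>map (\<lambda>(a, v). (a, blinfun_apply S v)) xs.
          blinfun_apply a (blinfun_apply (V j) v))" for j
      using xs by (induction xs) (auto simp: blinfun.add_right comm V)
    then show ?thesis
      unfolding amplified_span_def z_eq using xs
      by (auto intro!: exI[of _ "map (\<lambda>(a, v). (a, blinfun_apply S v)) xs"])
  qed
qed

context tuple_subspace
begin

text \<open>Invariance under \<open>S\<close> keeps the closure of \<open>K\<close> stable,
  invariance under \<open>adj S\<close> keeps its orthogonal complement stable; so \<open>S\<close>
  commutes with the projection.\<close>

lemma is_proj_intertwine:
  assumes S: "S \<in> bounded_ops"
    and inv: "\<And>u. u \<in> K \<Longrightarrow> (\<lambda>i. blinfun_apply S (u i)) \<in> K"
      "\<And>u. u \<in> K \<Longrightarrow> (\<lambda>i. blinfun_apply (adj S) (u i)) \<in> K"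
    and p: "is_proj z p"
  shows "is_proj (\<lambda>i. blinfun_apply S (z i)) (\<lambda>i. blinfun_apply S (p i))"
proof -
  have "(\<Sum>i<m. cinner (blinfun_apply S (z i) - blinfun_apply S (p i)) (w i)) = 0"
    if "w \<in> K" for w
    using p inv(2)[OF that] unfolding is_proj_def
    by (simp add: cinner_adj[OF S] flip: blinfun.diff_right)
  then show ?thesis
    using p in_closure_image inv(1) unfolding is_proj_def by blast
qed

text \<open>
  The projection onto the closure of an invariant subspace is a matrix of operators commuting
  with the algebra and its commutant, that is, a matrix of scalars.
\<close>

lemma proj_matrix_scalar:
  fixes M :: "('h \<Rightarrow>\<^sub>L 'h) set"
  assumes fac: "factor M"
    and inv: "\<And>S u. S \<in> M \<or> S \<in> commutant M \<Longrightarrow> u \<in> K \<Longrightarrow> (\<lambda>i. blinfun_apply S (u i)) \<in> K"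
  obtains c where "\<And>z p i. is_proj z p \<Longrightarrow> i < m \<Longrightarrow> p i = (\<Sum>j<m. c i j *\<^sub>C z j)"
proof -
  have M: "von_neumann_algebra M"
    using fac by (simp add: factor_def)
  obtain Q where Q: "\<And>z. is_proj z (Q z)"
    using is_proj_exists by metis
  define sgl :: "nat \<Rightarrow> 'h \<Rightarrow> nat \<Rightarrow> 'h" where "sgl j v l = (if l = j then v else 0)" for j v l
  define P where "P i j = Blinfun (\<lambda>v. Q (sgl j v) i)" for i j
  have P_apply: "blinfun_apply (P i j) v = Q (sgl j v) i" if "i < m" "j < m" for i j v
  proof -
    have "bounded_linear (\<lambda>v. Q (sgl j v) i)"
    proof (rule bounded_linear_intro[where K = 1])
      show "Q (sgl j (v + w)) i = Q (sgl j v) i + Q (sgl j w) i" for v w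
        by (rule is_proj_unique[OF Q is_proj_add[OF Q Q] _ \<open>i < m\<close>]) (simp add: sgl_def)
      show "Q (sgl j (r *\<^sub>R v)) i = r *\<^sub>R Q (sgl j v) i" for r v
        unfolding scaleC_of_real[symmetric]
        by (rule is_proj_unique[OF Q is_proj_scaleC[OF Q] _ \<open>i < m\<close>]) (simp add: sgl_def)
      show "norm (Q (sgl j v) i) \<le> norm v * 1" for v
      proof -
        have "(norm (Q (sgl j v) i))\<^sup>2 \<le> (\<Sum>l<m. (norm (sgl j v l))\<^sup>2)"
          by (rule is_proj_norm_le[OF Q \<open>i < m\<close>])
        also have "\<dots> = (\<Sum>l<m. if l = j then (norm v)\<^sup>2 else 0)"
          by (intro sum.cong) (auto simp: sgl_def)
        also have "\<dots> = (norm v)\<^sup>2"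
          using \<open>j < m\<close> by simp
        finally show ?thesis
          by (simp add: power_mono_iff)
      qed
    qed
    then show ?thesis
      by (simp add: P_def bounded_linear_Blinfun_apply)
  qed
  have P_bounded: "P i j \<in> bounded_ops" if "i < m" "j < m" for i j
  proof (rule bounded_opsI)
    show "blinfun_apply (P i j) (c *\<^sub>C v) = c *\<^sub>C blinfun_apply (P i j) v" for c v
      unfolding P_apply[OF that]
      by (rule is_proj_unique[OF Q is_proj_scaleC[OF Q] _ \<open>i < m\<close>]) (simp add: sgl_def)
  qed
  have P_comm: "P i j o\<^sub>L S = S o\<^sub>L P i j"
    if ij: "i < m" "j < m" and S: "S \<in> M \<or> S \<in> commutant M" for i j S
  proof -
    have bS: "S \<in> bounded_ops"
      using S vna_bounded[OF M] by (auto simp: commutant_def)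
    have adjS: "adj S \<in> M \<or> adj S \<in> commutant M"
      using S vna_adj[OF M] commutant_adj[OF M] by blast
    have "Q (sgl j (blinfun_apply S v)) i = blinfun_apply S (Q (sgl j v) i)" for v
      by (rule is_proj_unique[OF Q is_proj_intertwine[OF bS inv[OF S] inv[OF adjS] Q] _ \<open>i < m\<close>])
        (simp_all add: sgl_def)
    then show ?thesis
      by (intro blinfun_eqI) (simp add: P_apply ij)
  qed
  have "\<exists>c. P i j = scalar_op c" if "i < m" "j < m" for i j
  proof -
    have "P i j \<in> commutant M"
      using that P_bounded P_comm by (simp add: commutant_def)
    moreover have "P i j \<in> commutant (commutant M)"
      using that P_bounded P_comm unfolding commutant_def[of "commutant M"] by simp
    ultimately have "P i j \<in> M \<inter> commutant M"
      using vna_bicommutant[OF M] by simp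
    then show ?thesis
      using fac by (auto simp: factor_def)
  qed
  then obtain c where c: "\<And>i j. i < m \<Longrightarrow> j < m \<Longrightarrow> P i j = scalar_op (c i j)"
    by metis
  have "p i = (\<Sum>j<m. c i j *\<^sub>C z j)" if zp: "is_proj z p" and i: "i < m" for z p i
  proof -
    have "p i = (\<Sum>j<m. Q (sgl j (z j)) i)"
    proof (rule is_proj_unique[OF zp is_proj_sum[OF _ Q] _ i])
      show "z l = (\<Sum>j<m. sgl j (z j) l)" if "l < m" for l
      proof -
        have "(\<Sum>j<m. sgl j (z j) l) = (\<Sum>j<m. if l = j then z j else 0)"
          by (simp add: sgl_def)
        then show ?thesis
          using that by simp
      qed
    qed simp
    also have "\<dots> = (\<Sum>j<m. c i j *\<^sub>C z j)"
      using i by (intro sum.cong) (auto simp: c simp flip: P_apply)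
    finally show ?thesis .
  qed
  then show ?thesis
    using that by blast
qed

end

text \<open>The tuple \<open>z\<close> lies in the span, so the scalar matrix of the projection
  fixes it. A complex linear \<open>T\<close> acting diagonally commutes with scalar matrices; hence
  the image of \<open>z\<close> under \<open>T\<close> is fixed too and lies in the closure.\<close>

lemma amplified_span_dense:
  fixes M :: "('h::complex_hilbert \<Rightarrow>\<^sub>L 'h) set"
  assumes fac: "factor M" and V: "\<And>j. V j \<in> M" and T: "T \<in> bounded_ops"
  shows "tuple_subspace.in_closure m (amplified_span M V)
    (\<lambda>j. blinfun_apply T (blinfun_apply (V j) y))"
proof -
  have M: "von_neumann_algebra M"
    using fac by (simp add: factor_def)
  interpret tuple_subspace m "amplified_span M V"
    by (rule tuple_subspace_amplified_span[OF M])
  obtain c where c: "\<And>z p i. is_proj z p \<Longrightarrow> i < m \<Longrightarrow> p i = (\<Sum>j<m. c i j *\<^sub>C z j)"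
    using proj_matrix_scalar[OF fac amplified_span_invariant[of M V, OF M V]] by metis
  define z where "z j = blinfun_apply (V j) y" for j
  have "z \<in> amplified_span M V"
    unfolding amplified_span_def z_def using vna_one[OF M]
    by (auto intro!: exI[of _ "[(id_blinfun, y)]"])
  then have z: "z i = (\<Sum>j<m. c i j *\<^sub>C z j)" if "i < m" for i
    using c is_proj_self that by blast
  obtain p where p: "is_proj (\<lambda>j. blinfun_apply T (z j)) p"
    using is_proj_exists by blast
  have "p i = blinfun_apply T (z i)" if i: "i < m" for i
  proof -
    have "p i = (\<Sum>j<m. c i j *\<^sub>C blinfun_apply T (z j))"
      by (rule c[OF p i])
    also have "\<dots> = blinfun_apply T (\<Sum>j<m. c i j *\<^sub>C z j)"
      by (simp add: blinfun.sum_right bounded_opsD[OF T])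
    also have "\<dots> = blinfun_apply T (z i)"
      using z[OF i] by simp
    finally show ?thesis .
  qed
  then show ?thesis
    using p unfolding is_proj_def in_closure_def z_def by auto
qed

section \<open>Elementary operators\<close>

lemma sum_nonneg_Reals:
  "(\<And>i. i \<in> I \<Longrightarrow> f i \<in> \<real>\<^sub>\<ge>\<^sub>0) \<Longrightarrow> sum f I \<in> (\<real>\<^sub>\<ge>\<^sub>0 :: complex set)"
  by (induction I rule: infinite_finite_induct) auto

lemma cinner_self_nonneg: "cinner v v \<in> \<real>\<^sub>\<ge>\<^sub>0" for v :: "'h::complex_hilbert"
  by (simp add: cinner_self)

lemma positive_op_cinner: "positive_op T \<Longrightarrow> cinner (blinfun_apply T v) v \<in> \<real>\<^sub>\<ge>\<^sub>0"
  by (simp add: positive_op_def)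

lemma clinear_on_elementary:
  assumes "\<And>i. i \<in> I \<Longrightarrow> A i \<in> bounded_ops"
  shows "clinear_on S (\<lambda>C. \<Sum>i\<in>I. A i o\<^sub>L C o\<^sub>L B i)"
  unfolding clinear_on_def
  by (auto simp: compose_add add_compose sum.distrib compose_scale_op scale_op_compose assms
      scale_op_sum)

lemma positive_op_conjugate:
  assumes "positive_op C" "V \<in> bounded_ops"
  shows "positive_op (adj V o\<^sub>L C o\<^sub>L V)"
  using assms unfolding positive_op_def
  by (simp add: compose_in_bounded_ops adj_in_bounded_ops cinner_adj')

lemma positive_op_sum:
  "(\<And>i. i \<in> I \<Longrightarrow> positive_op (T i)) \<Longrightarrow> positive_op (sum T I)"
  unfolding positive_op_def
  by (simp add: sum_in_bounded_ops blinfun.sum_left cinner.sum_left sum_nonneg_Reals)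

text \<open>Moving \<open>adj (V j)\<close> across the inner product turns the form of the image
  matrix at \<open>\<xi>\<close> into a sum over \<open>j\<close> of forms of \<open>C\<close> at
  the tuples with entries \<open>V j (\<xi> q)\<close>.\<close>

lemma completely_positive_on_Kraus:
  assumes S: "S \<subseteq> bounded_ops" and V: "\<And>j. j \<in> J \<Longrightarrow> V j \<in> bounded_ops"
    and \<phi>: "\<And>C. C \<in> S \<Longrightarrow> \<phi> C = (\<Sum>j\<in>J. adj (V j) o\<^sub>L C o\<^sub>L V j)"
    and lin: "clinear_on S \<phi>"
  shows "completely_positive_on S \<phi>"
  unfolding completely_positive_on_def
proof (intro conjI allI impI lin)
  fix n C
  assume CS: "\<forall>p<n. \<forall>q<n. C p q \<in> S" and pos: "positive_op_matrix n C"
  have posC: "(\<Sum>p<n. cinner (\<Sum>q<n. blinfun_apply (C p q) (\<eta> q)) (\<eta> p)) \<in> \<real>\<^sub>\<ge>\<^sub>0" for \<eta>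
    using pos by (simp add: positive_op_matrix_def)
  have bC: "C p q \<in> bounded_ops" if "p < n" "q < n" for p q
    using that CS S by blast
  have "(\<Sum>p<n. cinner (\<Sum>q<n. blinfun_apply (\<phi> (C p q)) (\<xi> q)) (\<xi> p)) \<in> \<real>\<^sub>\<ge>\<^sub>0" for \<xi>
  proof -
    have "(\<Sum>p<n. cinner (\<Sum>q<n. blinfun_apply (\<phi> (C p q)) (\<xi> q)) (\<xi> p))
      = (\<Sum>p<n. \<Sum>q<n. \<Sum>j\<in>J. cinner (blinfun_apply (C p q) (blinfun_apply (V j) (\<xi> q)))
            (blinfun_apply (V j) (\<xi> p)))"
      using CS by (intro sum.cong refl)
        (simp add: \<phi> cinner.sum_left blinfun.sum_left cinner_adj' V)
    also have "\<dots> = (\<Sum>p<n. \<Sum>j\<in>J. \<Sum>q<n. cinner (blinfun_apply (C p q) (blinfun_apply (V j) (\<xi> q)))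
            (blinfun_apply (V j) (\<xi> p)))"
      by (intro sum.cong refl sum.swap)
    also have "\<dots> = (\<Sum>j\<in>J. \<Sum>p<n. \<Sum>q<n. cinner (blinfun_apply (C p q) (blinfun_apply (V j) (\<xi> q)))
            (blinfun_apply (V j) (\<xi> p)))"
      by (rule sum.swap)
    also have "\<dots> = (\<Sum>j\<in>J. \<Sum>p<n. cinner (\<Sum>q<n. blinfun_apply (C p q) (blinfun_apply (V j) (\<xi> q)))
            (blinfun_apply (V j) (\<xi> p)))"
      by (simp add: cinner.sum_left)
    also have "\<dots> \<in> \<real>\<^sub>\<ge>\<^sub>0"
      by (intro sum_nonneg_Reals posC)
    finally show ?thesis .
  qed
  moreover have "\<phi> (C p q) \<in> bounded_ops" if "p < n" "q < n" for p q
    using that CS by (auto simp: \<phi> intro!: sum_in_bounded_ops compose_in_bounded_ops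
        adj_in_bounded_ops V bC)
  ultimately show "positive_op_matrix n (\<lambda>p q. \<phi> (C p q))"
    unfolding positive_op_matrix_def by blast
qed

text \<open>
  Complete positivity, tested on the matrices \<open>(a\<^sub>p\<^sup>* a\<^sub>q)\<close>, says that
  \<open>\<Sum>\<^sub>i \<langle>z\<^sub>i, w\<^sub>i\<rangle> \<ge> 0\<close> for the tuples \<open>(z, w)\<close> in the span generated by
  \<open>B\<^sub>1, \<dots>, B\<^sub>k, A\<^sub>1\<^sup>*, \<dots>, A\<^sub>k\<^sup>*\<close>.
\<close>

lemma completely_positive_imp_positive:
  fixes M :: "('h::complex_hilbert \<Rightarrow>\<^sub>L 'h) set" and k :: nat
  assumes fac: "factor M"
    and A: "\<And>i. i \<in> {1..k} \<Longrightarrow> A i \<in> M" and B: "\<And>i. i \<in> {1..k} \<Longrightarrow> B i \<in> M"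
    and \<phi>: "\<And>C. C \<in> M \<Longrightarrow> \<phi> C = (\<Sum>i=1..k. A i o\<^sub>L C o\<^sub>L B i)"
    and cp: "completely_positive_on M \<phi>" and T: "T \<in> bounded_ops"
  shows "(\<Sum>i=1..k. cinner (blinfun_apply T (blinfun_apply (B i) y))
    (blinfun_apply T (blinfun_apply (adj (A i)) y))) \<in> \<real>\<^sub>\<ge>\<^sub>0"
proof -
  have M: "von_neumann_algebra M"
    using fac by (simp add: factor_def)
  \<comment> \<open>Positions 1 to \<open>k\<close> hold the \<open>B i\<close>, positions
    \<open>k + 1\<close> to \<open>2 * k\<close> the \<open>adj (A i)\<close>, so one approximation
    serves both families at once. Position 0 is padding, since the sums start at 1;
    \<open>m = 2 * k + 1\<close> then covers all of them.\<close>
  define V where "V j = (if j \<in> {1..k} then B j else if j \<in> {k+1..2*k} then adj (A (j - k)) else 0)"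
    for j
  define m where "m = 2 * k + 1"
  have V: "V j \<in> M" for j
  proof -
    have "j - k \<in> {1..k}" if "j \<in> {k+1..2*k}"
      using that by auto
    then show ?thesis
      unfolding V_def using A B vna_adj[OF M] vna_zero[OF M] by presburger
  qed
  have bA: "A i \<in> bounded_ops" if "i \<in> {1..k}" for i
    using vna_bounded[OF M A[OF that]] .
  have V_B: "V i = B i" and V_A: "V (k + i) = adj (A i)" if "i \<in> {1..k}" for i
    using that by (auto simp: V_def)
  interpret tuple_subspace m "amplified_span M V"
    by (rule tuple_subspace_amplified_span[OF M])
  have pos: "(\<Sum>i=1..k. cinner (z i) (z (k + i))) \<in> \<real>\<^sub>\<ge>\<^sub>0" if z: "z \<in> amplified_span M V" for z
  proof -
    obtain xs where xs: "set xs \<subseteq> M \<times> UNIV"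
      and z_eq: "z = (\<lambda>j. \<Sum>(a, v)\<leftarrow>xs. blinfun_apply a (blinfun_apply (V j) v))"
      using z unfolding amplified_span_def by blast
    define n where "n = length xs"
    define a where "a q = fst (xs ! q)" for q
    define \<xi> where "\<xi> q = snd (xs ! q)" for q
    have aM: "a q \<in> M" if "q < n" for q
      using xs nth_mem[of q xs] that unfolding a_def n_def by fastforce
    have ba: "a q \<in> bounded_ops" if "q < n" for q
      using aM[OF that] vna_bounded[OF M] by blast
    have z_sum: "z j = (\<Sum>q<n. blinfun_apply (a q) (blinfun_apply (V j) (\<xi> q)))" for j
      unfolding z_eq by (simp add: sum_list_sum_nth case_prod_unfold a_def \<xi>_def n_def atLeast0LessThan)
    \<comment> \<open>This matrix is the adjoint of the row of the \<open>a q\<close> times that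
      row; its form at \<open>\<eta>\<close> is the squared norm of the sum of the
      \<open>a q (\<eta> q)\<close>.\<close>
    define C where "C p q = adj (a p) o\<^sub>L a q" for p q
    have CM: "C p q \<in> M" if "p < n" "q < n" for p q
      unfolding C_def using that aM vna_compose[OF M] vna_adj[OF M] by blast
    have \<phi>C: "\<phi> (C p q) = (\<Sum>i=1..k. A i o\<^sub>L (adj (a p) o\<^sub>L a q) o\<^sub>L B i)"
      if "p < n" "q < n" for p q
      using \<phi>[OF CM[OF that]] by (simp add: C_def)
    have "(\<Sum>p<n. cinner (\<Sum>q<n. blinfun_apply (C p q) (\<eta> q)) (\<eta> p)) \<in> \<real>\<^sub>\<ge>\<^sub>0" for \<eta>
    proof -
      have "(\<Sum>p<n. cinner (\<Sum>q<n. blinfun_apply (C p q) (\<eta> q)) (\<eta> p))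
        = cinner (\<Sum>q<n. blinfun_apply (a q) (\<eta> q)) (\<Sum>q<n. blinfun_apply (a q) (\<eta> q))"
        unfolding cinner.sum_right
        by (intro sum.cong refl) (simp add: C_def ba cinner_adj' flip: blinfun.sum_right)
      then show ?thesis
        by (simp only: cinner_self_nonneg)
    qed
    then have "positive_op_matrix n C"
      unfolding positive_op_matrix_def using CM vna_bounded[OF M] by blast
    then have "positive_op_matrix n (\<lambda>p q. \<phi> (C p q))"
      using cp CM unfolding completely_positive_on_def by blast
    then have "(\<Sum>p<n. cinner (\<Sum>q<n. blinfun_apply (\<phi> (C p q)) (\<xi> q)) (\<xi> p)) \<in> \<real>\<^sub>\<ge>\<^sub>0"
      unfolding positive_op_matrix_def by blast
    also have "(\<Sum>p<n. cinner (\<Sum>q<n. blinfun_apply (\<phi> (C p q)) (\<xi> q)) (\<xi> p))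
      = (\<Sum>p<n. \<Sum>q<n. \<Sum>i=1..k. cinner (blinfun_apply (a q) (blinfun_apply (B i) (\<xi> q)))
          (blinfun_apply (a p) (blinfun_apply (adj (A i)) (\<xi> p))))"
      by (intro sum.cong refl)
        (simp add: \<phi>C cinner.sum_left blinfun.sum_left cinner_adj[OF bA] cinner_adj'[OF ba])
    also have "\<dots> = (\<Sum>p<n. \<Sum>i=1..k. \<Sum>q<n. cinner (blinfun_apply (a q) (blinfun_apply (B i) (\<xi> q)))
          (blinfun_apply (a p) (blinfun_apply (adj (A i)) (\<xi> p))))"
      by (intro sum.cong refl sum.swap)
    also have "\<dots> = (\<Sum>i=1..k. \<Sum>p<n. \<Sum>q<n. cinner (blinfun_apply (a q) (blinfun_apply (B i) (\<xi> q)))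
          (blinfun_apply (a p) (blinfun_apply (adj (A i)) (\<xi> p))))"
      by (rule sum.swap)
    also have "\<dots> = (\<Sum>i=1..k. cinner (z i) (z (k + i)))"
      by (intro sum.cong refl) (simp only: z_sum V_B V_A cinner.sum_left cinner.sum_right)
    finally show ?thesis .
  qed
  \<comment> \<open>The wanted sum is a limit of the sums treated in \<open>pos\<close>, and the
    nonnegative reals are closed.\<close>
  obtain u where u: "\<And>n. u n \<in> amplified_span M V"
    and lim: "\<And>j. j < m \<Longrightarrow> (\<lambda>n. u n j) \<longlonglongrightarrow> blinfun_apply T (blinfun_apply (V j) y)"
    using amplified_span_dense[where V = V and m = m and y = y, OF fac V T] unfolding in_closure_def by blast
  have "(\<lambda>n. \<Sum>i=1..k. cinner (u n i) (u n (k + i)))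
    \<longlonglongrightarrow> (\<Sum>i=1..k. cinner (blinfun_apply T (blinfun_apply (V i) y))
        (blinfun_apply T (blinfun_apply (V (k + i)) y)))"
    by (intro tendsto_sum cinner.tendsto lim) (auto simp: m_def)
  then have "(\<Sum>i=1..k. cinner (blinfun_apply T (blinfun_apply (V i) y))
        (blinfun_apply T (blinfun_apply (V (k + i)) y))) \<in> \<real>\<^sub>\<ge>\<^sub>0"
    by (rule closed_sequentially[OF closed_nonneg_Reals_complex pos[OF u]])
  then show ?thesis
    by (simp add: V_B V_A)
qed


section \<open>Positive tensors\<close>

text \<open>
  An identity \<open>\<Sum>\<^sub>i f(A\<^sub>i, B\<^sub>i) = \<Sum>\<^sub>j f(C\<^sub>j, D\<^sub>j)\<close> for all balanced \<open>f\<close> stands for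
  \<open>\<Sum>\<^sub>i A\<^sub>i \<otimes> B\<^sub>i = \<Sum>\<^sub>j C\<^sub>j \<otimes> D\<^sub>j\<close> in the algebraic tensor product.
\<close>

definition balanced ::
    "(('h::complex_hilbert \<Rightarrow>\<^sub>L 'h) \<Rightarrow> ('h \<Rightarrow>\<^sub>L 'h) \<Rightarrow> 'h \<Rightarrow>\<^sub>L 'h) \<Rightarrow> bool"
  where "balanced f \<longleftrightarrow>
    (\<forall>X\<in>bounded_ops. \<forall>X'\<in>bounded_ops. \<forall>Y\<in>bounded_ops. f (X + X') Y = f X Y + f X' Y) \<and>
    (\<forall>X\<in>bounded_ops. \<forall>Y\<in>bounded_ops. \<forall>Y'\<in>bounded_ops. f X (Y + Y') = f X Y + f X Y') \<and>
    (\<forall>c. \<forall>X\<in>bounded_ops. \<forall>Y\<in>bounded_ops. f (c *\<^sub>O X) Y = f X (c *\<^sub>O Y))"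

lemma balanced_add_left:
    "balanced f \<Longrightarrow> X \<in> bounded_ops \<Longrightarrow> X' \<in> bounded_ops \<Longrightarrow> Y \<in> bounded_ops \<Longrightarrow>
      f (X + X') Y = f X Y + f X' Y"
  and balanced_add_right:
    "balanced f \<Longrightarrow> X \<in> bounded_ops \<Longrightarrow> Y \<in> bounded_ops \<Longrightarrow> Y' \<in> bounded_ops \<Longrightarrow>
      f X (Y + Y') = f X Y + f X Y'"
  and balanced_scale:
    "balanced f \<Longrightarrow> X \<in> bounded_ops \<Longrightarrow> Y \<in> bounded_ops \<Longrightarrow> f (c *\<^sub>O X) Y = f X (c *\<^sub>O Y)"
  unfolding balanced_def by auto

lemma balanced_zero_left: "balanced f \<Longrightarrow> Y \<in> bounded_ops \<Longrightarrow> f 0 Y = 0"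
  using balanced_add_left[of f 0 0 Y] zero_in_bounded_ops by simp

lemma balanced_zero_right: "balanced f \<Longrightarrow> X \<in> bounded_ops \<Longrightarrow> f X 0 = 0"
  using balanced_add_right[of f X 0 0] zero_in_bounded_ops by simp

lemma balanced_sum_left:
  "balanced f \<Longrightarrow> (\<And>i. i \<in> I \<Longrightarrow> X i \<in> bounded_ops) \<Longrightarrow> Y \<in> bounded_ops \<Longrightarrow>
    f (\<Sum>i\<in>I. X i) Y = (\<Sum>i\<in>I. f (X i) Y)"
  by (induction I rule: infinite_finite_induct)
    (simp_all add: balanced_zero_left balanced_add_left sum_in_bounded_ops)

lemma balanced_sum_right:
  "balanced f \<Longrightarrow> X \<in> bounded_ops \<Longrightarrow> (\<And>i. i \<in> I \<Longrightarrow> Y i \<in> bounded_ops) \<Longrightarrow>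
    f X (\<Sum>i\<in>I. Y i) = (\<Sum>i\<in>I. f X (Y i))"
  by (induction I rule: infinite_finite_induct)
    (simp_all add: balanced_zero_right balanced_add_right sum_in_bounded_ops)

text \<open>A tensor identity is evaluated through these two maps: the first gives the elementary
  operator itself, the second the one with the factors exchanged, which links
  \<open>C\<^sub>\<phi>\<close> to \<open>D\<^sub>\<phi>\<close>.\<close>

lemma balanced_sandwich:
  assumes "C \<in> bounded_ops"
  shows "balanced (\<lambda>X Y. X o\<^sub>L C o\<^sub>L Y)" "balanced (\<lambda>X Y. Y o\<^sub>L C o\<^sub>L X)"
  using assms unfolding balanced_def
  by (auto simp: blinfun.add_left blinfun.add_right bounded_opsD intro!: blinfun_eqI)

text \<open>The relation expresses \<open>B i1\<close> by the other second factors; moving its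
  coefficients across the tensor sign shortens the sum by one term.\<close>

lemma balanced_sum_reduce:
  assumes f: "balanced f" and "finite I"
    and A: "\<And>i. i \<in> I \<Longrightarrow> A i \<in> bounded_ops" and B: "\<And>i. i \<in> I \<Longrightarrow> B i \<in> bounded_ops"
    and rel: "(\<Sum>i\<in>I. d i *\<^sub>O B i) = 0" and i1: "i1 \<in> I" and d: "d i1 \<noteq> 0"
  shows "(\<Sum>i\<in>I. f (A i) (B i)) = (\<Sum>i\<in>I - {i1}. f (A i + (- (d i / d i1)) *\<^sub>O A i1) (B i))"
proof -
  have "B i1 = (\<Sum>i\<in>I - {i1}. (- (d i / d i1)) *\<^sub>O B i)"
  proof (rule blinfun_eqI)
    fix v
    have "(\<Sum>i\<in>I. d i *\<^sub>C blinfun_apply (B i) v) = 0"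
      using arg_cong[OF rel, of "\<lambda>T. blinfun_apply T v"] by (simp add: blinfun.sum_left)
    then have "d i1 *\<^sub>C blinfun_apply (B i1) v + (\<Sum>i\<in>I - {i1}. d i *\<^sub>C blinfun_apply (B i) v) = 0"
      using \<open>finite I\<close> i1 by (simp add: sum.remove)
    then have "(1 / d i1) *\<^sub>C (d i1 *\<^sub>C blinfun_apply (B i1) v
        + (\<Sum>i\<in>I - {i1}. d i *\<^sub>C blinfun_apply (B i) v)) = 0"
      by simp
    then have "blinfun_apply (B i1) v
        = - (\<Sum>i\<in>I - {i1}. (d i / d i1) *\<^sub>C blinfun_apply (B i) v)"
      using d by (simp add: scaleC_add_right scaleC_scaleC scaleC_sum_right eq_neg_iff_add_eq_0)
    then show "blinfun_apply (B i1) v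
        = blinfun_apply (\<Sum>i\<in>I - {i1}. (- (d i / d i1)) *\<^sub>O B i) v"
      by (simp add: blinfun.sum_left scaleC_minus_left sum_negf)
  qed
  then have "f (A i1) (B i1) = f (A i1) (\<Sum>i\<in>I - {i1}. (- (d i / d i1)) *\<^sub>O B i)"
    by simp
  also have "\<dots> = (\<Sum>i\<in>I - {i1}. f (A i1) ((- (d i / d i1)) *\<^sub>O B i))"
    using A B i1 by (intro balanced_sum_right[OF f] scale_op_in_bounded_ops) auto
  also have "\<dots> = (\<Sum>i\<in>I - {i1}. f ((- (d i / d i1)) *\<^sub>O A i1) (B i))"
    using A B i1 by (intro sum.cong refl balanced_scale[OF f, symmetric]) auto
  finally have "f (A i1) (B i1) = (\<Sum>i\<in>I - {i1}. f ((- (d i / d i1)) *\<^sub>O A i1) (B i))" .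
  then show ?thesis
    using \<open>finite I\<close> i1 A B
    by (simp add: sum.remove balanced_add_left[OF f] scale_op_in_bounded_ops sum.distrib)
qed

text \<open>Polarization: the form is real at \<open>y + z\<close> and at
  \<open>y + \<i> *\<^sub>C z\<close>, which settles the imaginary and the real part.\<close>

lemma positive_op_symmetric:
  assumes "positive_op T"
  shows "cinner (blinfun_apply T y) z = cinner y (blinfun_apply T z)"
proof -
  define p where "p = cinner (blinfun_apply T y) z"
  define r where "r = cinner (blinfun_apply T z) y"
  have T: "T \<in> bounded_ops"
    using assms by (simp add: positive_op_def)
  have im: "Im (cinner (blinfun_apply T v) v) = 0" for v
    using positive_op_cinner[OF assms] complex_nonneg_Reals_iff by blast
  have "Im (p + r) = 0"
    using im[of "y + z"] im[of y] im[of z]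
    by (simp add: p_def r_def blinfun.add_right cinner.add_left cinner.add_right)
  moreover have "Re p = Re r"
    using im[of "y + \<i> *\<^sub>C z"] im[of y] im[of z]
    by (simp add: p_def r_def blinfun.add_right cinner.add_left cinner.add_right bounded_opsD[OF T]
        cinner_scaleC_left cinner_scaleC_right)
  ultimately have "p = cnj r"
    by (simp add: complex_eq_iff)
  then show ?thesis
    unfolding p_def r_def by (metis cinner_commute)
qed

text \<open>By symmetry, the form at \<open>y + T y\<close> is twice the squared norm of
  \<open>T y\<close>.\<close>

lemma positive_op_eq_zero:
  assumes "positive_op T" and zero: "\<And>v. cinner (blinfun_apply T v) v = 0"
  shows "T = 0"
proof (rule blinfun_eqI)
  fix y
  define z where "z = blinfun_apply T y"
  have "cinner (blinfun_apply T z) y = cnj (cinner z z)"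
    unfolding z_def positive_op_symmetric[OF assms(1), of y "blinfun_apply T y"]
    by (metis cinner_commute)
  then have "cinner z z + cnj (cinner z z) = 0"
    using zero[of "y + z"] zero[of y] zero[of z]
    by (simp add: blinfun.add_right cinner.add_left cinner.add_right z_def
        add.commute)
  then have "z = 0"
    by (simp add: cinner_self complex_eq_iff)
  then show "blinfun_apply T y = blinfun_apply 0 y"
    by (simp add: z_def)
qed

lemma positive_tensor_decomposition:
  fixes M :: "('h::complex_hilbert \<Rightarrow>\<^sub>L 'h) set"
  assumes M: "von_neumann_algebra M" and sep: "separating_vector M x"
    and E_bounded: "E \<in> bounded_ops" and E: "\<And>v. blinfun_apply E v = cinner v x *\<^sub>C x"
    and "finite I" and "\<And>i. i \<in> I \<Longrightarrow> A i \<in> M" and "\<And>i. i \<in> I \<Longrightarrow> B i \<in> M"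
    and "positive_op (\<Sum>i\<in>I. A i o\<^sub>L E o\<^sub>L B i)"
  shows "\<exists>(m::nat) V. (\<forall>j\<in>{1..m}. V j \<in> M) \<and>
    (\<forall>f. balanced f \<longrightarrow> (\<Sum>i\<in>I. f (A i) (B i)) = (\<Sum>j=1..m. f (adj (V j)) (V j)))"
  using assms(5-)
proof (induction "card I" arbitrary: I A B)
  case 0
  then show ?case
    by (intro exI[of _ 0]) auto
next
  case (Suc n)
  note A = Suc.prems(2) and B = Suc.prems(3)
  have bA: "A i \<in> bounded_ops" and bB: "B i \<in> bounded_ops" if "i \<in> I" for i
    using A B that vna_bounded[OF M] by blast+
  \<comment> \<open>The separating vector turns identities at \<open>x\<close> into identities in
    \<open>M\<close>.\<close>
  have eq_if: "S = T" if "S \<in> M" "T \<in> M" "blinfun_apply S x = blinfun_apply T x" for S T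
  proof -
    have "S + (-1) *\<^sub>O T \<in> M"
      using that by (intro vna_add[OF M] vna_scale[OF M])
    then have "S + (-1) *\<^sub>O T = 0"
      using sep that unfolding separating_vector_def by (simp add: blinfun.add_left)
    then have "blinfun_apply (S + (-1) *\<^sub>O T) v = 0" for v
      by simp
    then have "blinfun_apply S v = blinfun_apply T v" for v
      by (simp add: blinfun.add_left)
    then show ?thesis
      by (rule blinfun_eqI)
  qed
  \<comment> \<open>The induction hypothesis in usable form. \<open>B'\<close> is kept general
    because it is needed both for \<open>B\<close> itself and for the residual family.\<close>
  have reduce: "\<exists>(m::nat) V. (\<forall>j\<in>{1..m}. V j \<in> M) \<and>
      (\<forall>f. balanced f \<longrightarrow> (\<Sum>i\<in>I. f (A i) (B' i)) = (\<Sum>j=1..m. f (adj (V j)) (V j)))"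
    if B': "\<And>i. i \<in> I \<Longrightarrow> B' i \<in> M" and rel: "(\<Sum>i\<in>I. d i *\<^sub>O B' i) = 0"
      and i1: "i1 \<in> I" "d i1 \<noteq> 0" and pos: "positive_op (\<Sum>i\<in>I. A i o\<^sub>L E o\<^sub>L B' i)" for B' d i1
  proof -
    define A' where "A' i = A i + (- (d i / d i1)) *\<^sub>O A i1" for i
    have eq: "(\<Sum>i\<in>I. f (A i) (B' i)) = (\<Sum>i\<in>I - {i1}. f (A' i) (B' i))" if "balanced f" for f
      unfolding A'_def using bA B' vna_bounded[OF M]
      by (intro balanced_sum_reduce[OF that \<open>finite I\<close> _ _ rel i1]) auto
    have "positive_op (\<Sum>i\<in>I - {i1}. A' i o\<^sub>L E o\<^sub>L B' i)"
      using pos eq[OF balanced_sandwich(1)[OF E_bounded]] by simp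
    moreover have "A' i \<in> M" if "i \<in> I - {i1}" for i
      unfolding A'_def using that A i1 by (intro vna_add[OF M] vna_scale[OF M]) auto
    moreover have "n = card (I - {i1})"
      using Suc.hyps(2) i1 \<open>finite I\<close> by simp
    ultimately show ?thesis
      using Suc.hyps(1)[of "I - {i1}" A' B'] B' \<open>finite I\<close> by (simp add: eq)
  qed
  define a where "a i = blinfun_apply (A i) x" for i
  define b where "b i = blinfun_apply (adj (B i)) x" for i
  define T where "T = (\<Sum>i\<in>I. A i o\<^sub>L E o\<^sub>L B i)"
  have T: "positive_op T"
    unfolding T_def by (rule Suc.prems)
  have bT: "T \<in> bounded_ops"
    using T by (simp add: positive_op_def)
  have T_apply: "blinfun_apply T v = (\<Sum>i\<in>I. cinner v (b i) *\<^sub>C a i)" for v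
    unfolding T_def a_def b_def
    by (simp add: blinfun.sum_left E bounded_opsD[OF bA] cinner_adj[OF bB])
  \<comment> \<open>\<open>U v\<close> and \<open>W v\<close> are slices of the tensor, contracted
    in the second and in the first factor. At \<open>x\<close>, both \<open>U v\<close> and
    \<open>adj (W v)\<close> give \<open>T v\<close>, the latter by symmetry of \<open>T\<close>;
    hence \<open>adj (W v) = U v\<close>.\<close>
  define U where "U v = (\<Sum>i\<in>I. cinner v (b i) *\<^sub>O A i)" for v
  define W where "W v = (\<Sum>i\<in>I. cinner (a i) v *\<^sub>O B i)" for v
  have UM: "U v \<in> M" and WM: "W v \<in> M" for v
    unfolding U_def W_def using A B by (auto intro!: vna_sum[OF M] vna_scale[OF M])
  have U_x: "blinfun_apply (U v) x = blinfun_apply T v" for v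
    unfolding U_def T_apply a_def by (simp add: blinfun.sum_left)
  have adj_W_x: "blinfun_apply (adj (W v)) x = blinfun_apply T v" for v
  proof (rule cinner_right_ext)
    fix z
    have "cinner z (blinfun_apply (adj (W v)) x) = cinner (blinfun_apply (W v) z) x"
      using vna_bounded[OF M WM] by (simp add: cinner_adj)
    also have "\<dots> = (\<Sum>i\<in>I. cinner (a i) v * cinner z (b i))"
      unfolding W_def b_def
      by (simp add: blinfun.sum_left cinner.sum_left cinner_scaleC_left cinner_adj[OF bB])
    also have "\<dots> = cinner (blinfun_apply T z) v"
      by (simp add: T_apply cinner.sum_left cinner_scaleC_left mult.commute)
    also have "\<dots> = cinner z (blinfun_apply T v)"
      by (rule positive_op_symmetric[OF T])
    finally show "cinner z (blinfun_apply (adj (W v)) x) = cinner z (blinfun_apply T v)" .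
  qed
  have adj_W: "adj (W v) = U v" for v
    using eq_if[OF vna_adj[OF M WM] UM] U_x adj_W_x by simp
  show ?case
  proof (cases "\<forall>i\<in>I. A i = 0")
    case True
    then have "(\<Sum>i\<in>I. f (A i) (B i)) = 0" if "balanced f" for f
      using bB that by (simp add: balanced_zero_left)
    then show ?thesis
      by (intro exI[of _ 0]) auto
  next
    case False
    then obtain i0 where i0: "i0 \<in> I" "A i0 \<noteq> 0"
      by blast
    then have a_i0: "a i0 \<noteq> 0"
      using sep A unfolding separating_vector_def a_def by blast
    show ?thesis
    proof (cases "\<forall>v. cinner (blinfun_apply T v) v = 0")
      case True
      then have "T = 0"
        using positive_op_eq_zero[OF T] by blast
      \<comment> \<open>Here \<open>W (a i0) = 0\<close> is itself a linear relation among the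
        \<open>B i\<close>; its coefficient at \<open>i0\<close> is the squared norm of
        \<open>a i0\<close>, which is nonzero.\<close>
      then have "U (a i0) = 0"
        using eq_if[OF UM vna_zero[OF M]] U_x by simp
      then have "adj (adj (W (a i0))) = adj 0"
        by (simp add: adj_W)
      then have "W (a i0) = 0"
        using vna_bounded[OF M WM] adj_unique[OF zero_in_bounded_ops, of 0]
        by (simp add: adj_adj cinner.zero_left)
      then show ?thesis
        using reduce[of B "\<lambda>i. cinner (a i) (a i0)" i0] B i0 a_i0 Suc.prems(4)
        unfolding W_def by simp
    next
      case False
      then obtain y where y: "cinner (blinfun_apply T y) y \<noteq> 0"
        by blast
      define t where "t = Re (cinner (blinfun_apply T y) y)"
      have t_eq: "cinner (blinfun_apply T y) y = complex_of_real t"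
        and "t > 0"
        using positive_op_cinner[OF T, of y] y unfolding t_def complex_nonneg_Reals_iff
        by (auto simp: complex_eq_iff)
      define c where "c i = cinner y (b i)" for i
      define d where "d i = cinner (a i) y" for i
      have cd: "(\<Sum>i\<in>I. c i * d i) = complex_of_real t"
        unfolding t_eq[symmetric] T_apply c_def d_def
        by (simp add: cinner.sum_left cinner_scaleC_left)
      have "\<exists>i\<in>I. d i \<noteq> 0"
      proof (rule ccontr)
        assume "\<not> ?thesis"
        then have "(\<Sum>i\<in>I. c i * d i) = 0"
          by simp
        then show False
          using cd \<open>t > 0\<close> by simp
      qed
      then obtain i1 where i1: "i1 \<in> I" "d i1 \<noteq> 0"
        by blast
      \<comment> \<open>The residual after removing \<open>U y\<close> tensor \<open>W y\<close>,
        divided by \<open>t\<close>. The relation with coefficients \<open>d i\<close> holds because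
        the \<open>d i *\<^sub>O B i\<close> sum to \<open>W y\<close> and the products
        \<open>c i * d i\<close> sum to \<open>t\<close>.\<close>
      define B' where "B' i = B i + (- (c i / t)) *\<^sub>O W y" for i
      have B'M: "B' i \<in> M" if "i \<in> I" for i
        unfolding B'_def using B that WM by (intro vna_add[OF M] vna_scale[OF M])
      have rel: "(\<Sum>i\<in>I. d i *\<^sub>O B' i) = 0"
      proof (rule blinfun_eqI)
        fix v
        have "blinfun_apply (\<Sum>i\<in>I. d i *\<^sub>O B' i) v
          = (\<Sum>i\<in>I. d i *\<^sub>C blinfun_apply (B i) v)
            + (\<Sum>i\<in>I. (d i * - (c i / t)) *\<^sub>C blinfun_apply (W y) v)"
          by (simp add: B'_def blinfun.sum_left blinfun.add_left scaleC_add_right scaleC_scaleC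
              sum.distrib)
        also have "(\<Sum>i\<in>I. (d i * - (c i / t)) *\<^sub>C blinfun_apply (W y) v)
          = (\<Sum>i\<in>I. d i * - (c i / t)) *\<^sub>C blinfun_apply (W y) v"
          by (rule scaleC_sum_left[symmetric])
        also have "(\<Sum>i\<in>I. d i * - (c i / t)) = - ((\<Sum>i\<in>I. c i * d i) / t)"
          by (simp add: sum_divide_distrib sum_negf mult.commute)
        also have "\<dots> = -1"
          unfolding cd using \<open>t > 0\<close> by simp
        also have "(\<Sum>i\<in>I. d i *\<^sub>C blinfun_apply (B i) v) = blinfun_apply (W y) v"
          by (simp add: W_def d_def blinfun.sum_left)
        finally show "blinfun_apply (\<Sum>i\<in>I. d i *\<^sub>O B' i) v = blinfun_apply 0 v"
          by simp
      qed
      \<comment> \<open>The factor \<open>1 / t\<close> is shared equally between the two sides, so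
        that the removed piece is \<open>adj R\<close> tensor \<open>R\<close>.\<close>
      define r where "r = complex_of_real (1 / sqrt t)"
      define R where "R = r *\<^sub>O W y"
      have RM: "R \<in> M"
        unfolding R_def by (rule vna_scale[OF M WM])
      have adj_R: "adj R = r *\<^sub>O U y"
        unfolding R_def adj_scale_op[OF vna_bounded[OF M WM]] adj_W by (simp add: r_def)
      have r2: "r * r = 1 / t"
      proof -
        have "r * r = complex_of_real (1 / sqrt t * (1 / sqrt t))"
          unfolding r_def by (simp only: of_real_mult)
        also have "1 / sqrt t * (1 / sqrt t) = 1 / t"
          using \<open>t > 0\<close> by simp
        finally show ?thesis
          by simp
      qed
      have split: "(\<Sum>i\<in>I. f (A i) (B i)) = (\<Sum>i\<in>I. f (A i) (B' i)) + f (adj R) R"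
        if f: "balanced f" for f
      proof -
        have bW: "W y \<in> bounded_ops" and bU: "U y \<in> bounded_ops"
          using vna_bounded[OF M] WM UM by blast+
        have "f (A i) (B' i) = f (A i) (B i) - f ((c i / t) *\<^sub>O A i) (W y)" if "i \<in> I" for i
        proof -
          have "B i = B' i + (c i / t) *\<^sub>O W y"
            unfolding B'_def by (rule blinfun_eqI)
              (simp add: blinfun.add_left add.assoc flip: scaleC_add_left)
          then have "f (A i) (B i) = f (A i) (B' i) + f (A i) ((c i / t) *\<^sub>O W y)"
            using balanced_add_right[OF f bA[OF that] vna_bounded[OF M B'M[OF that]]
                scale_op_in_bounded_ops[OF bW]] by metis
          then show ?thesis
            using balanced_scale[OF f bA[OF that] bW] by simp
        qed
        then have "(\<Sum>i\<in>I. f (A i) (B' i))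
          = (\<Sum>i\<in>I. f (A i) (B i)) - (\<Sum>i\<in>I. f ((c i / t) *\<^sub>O A i) (W y))"
          by (simp add: sum_subtractf)
        also have "(\<Sum>i\<in>I. f ((c i / t) *\<^sub>O A i) (W y)) = f (\<Sum>i\<in>I. (c i / t) *\<^sub>O A i) (W y)"
          using bA bW by (simp add: balanced_sum_left[OF f] scale_op_in_bounded_ops)
        also have "(\<Sum>i\<in>I. (c i / t) *\<^sub>O A i) = r *\<^sub>O r *\<^sub>O U y"
          by (simp add: U_def c_def scale_op_sum scale_op_scale_op r2 flip: mult.assoc)
        also have "f \<dots> (W y) = f (adj R) R"
          unfolding adj_R unfolding R_def
          by (intro balanced_scale[OF f] scale_op_in_bounded_ops bU bW)
        finally show ?thesis
          by simp
      qed
      have pos': "positive_op (\<Sum>i\<in>I. A i o\<^sub>L E o\<^sub>L B' i)"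
        unfolding positive_op_def
      proof (intro conjI allI)
        show "(\<Sum>i\<in>I. A i o\<^sub>L E o\<^sub>L B' i) \<in> bounded_ops"
          using bA vna_bounded[OF M B'M]
          by (intro sum_in_bounded_ops compose_in_bounded_ops E_bounded)
        fix z
        define g where "g = cinner (blinfun_apply T z) y"
        \<comment> \<open>\<open>w\<close> is the part of \<open>z\<close> orthogonal to
          \<open>y\<close> for the form of \<open>T\<close>. Completing the square shows that the
          residual form at \<open>z\<close> is the form of \<open>T\<close> at
          \<open>w\<close>.\<close>
        define w where "w = z + (- (g / t)) *\<^sub>C y"
        have W_z: "cinner (blinfun_apply (W y) z) x = g"
          using positive_op_symmetric[OF T, of z y]
          by (simp add: g_def cinner_adj[OF vna_bounded[OF M WM]] adj_W_x)
        have "T = (\<Sum>i\<in>I. A i o\<^sub>L E o\<^sub>L B' i) + (adj R o\<^sub>L E o\<^sub>L R)"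
          unfolding T_def by (rule split[OF balanced_sandwich(1)[OF E_bounded]])
        then have "cinner (blinfun_apply (\<Sum>i\<in>I. A i o\<^sub>L E o\<^sub>L B' i) z) z
          = cinner (blinfun_apply T z) z - cinner (blinfun_apply (adj R o\<^sub>L E o\<^sub>L R) z) z"
          by (simp add: blinfun.add_left cinner.add_left)
        also have "cinner (blinfun_apply (adj R o\<^sub>L E o\<^sub>L R) z) z = g * cnj g / t"
        proof -
          have "cinner (blinfun_apply R z) x = r * g"
            by (simp add: R_def cinner_scaleC_left W_z)
          then have "cinner (blinfun_apply (adj R o\<^sub>L E o\<^sub>L R) z) z = r * g * cnj (r * g)"
            using cinner_commute[of x "blinfun_apply R z"]
            by (simp add: cinner_adj'[OF vna_bounded[OF M RM]] E cinner_scaleC_left)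
          also have "\<dots> = r * r * (g * cnj g)"
            by (simp add: r_def)
          finally show ?thesis
            by (simp add: r2)
        qed
        also have "cinner (blinfun_apply T z) z - g * cnj g / t = cinner (blinfun_apply T w) w"
        proof -
          have "cinner (blinfun_apply T y) z = cnj g"
            unfolding g_def positive_op_symmetric[OF T, of y z] by (rule cinner_commute)
          then show ?thesis
            unfolding w_def using \<open>t > 0\<close>
            by (simp add: blinfun.add_right bounded_opsD[OF bT] cinner.add_left cinner.add_right
                cinner_scaleC_left cinner_scaleC_right t_eq g_def[symmetric] field_simps)
        qed
        finally show "cinner (blinfun_apply (\<Sum>i\<in>I. A i o\<^sub>L E o\<^sub>L B' i) z) z \<in> \<real>\<^sub>\<ge>\<^sub>0"
          using positive_op_cinner[OF T] by simp
      qed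
      obtain m V where V: "\<forall>j\<in>{1..m::nat}. V j \<in> M"
        and V_eq: "\<And>f. balanced f \<Longrightarrow>
          (\<Sum>i\<in>I. f (A i) (B' i)) = (\<Sum>j=1..m. f (adj (V j)) (V j))"
        using reduce[OF B'M rel i1 pos'] by blast
      define V' where "V' = V(Suc m := R)"
      have "(\<Sum>i\<in>I. f (A i) (B i)) = (\<Sum>j=1..Suc m. f (adj (V' j)) (V' j))"
        if f: "balanced f" for f
      proof -
        have "(\<Sum>j=1..m. f (adj (V' j)) (V' j)) = (\<Sum>j=1..m. f (adj (V j)) (V j))"
          by (intro sum.cong) (auto simp: V'_def)
        then show ?thesis
          using split[OF f] V_eq[OF f] by (simp add: V'_def)
      qed
      moreover have "\<forall>j\<in>{1..Suc m}. V' j \<in> M"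
        using V RM by (auto simp: V'_def le_Suc_eq)
      ultimately show ?thesis
        by blast
    qed
  qed
qed

section \<open>The rank one projection and the equivalence of the conditions\<close>

lemma orth_projection_onto_span:
  assumes "norm x = 1" and E: "orth_projection_onto (range (\<lambda>c. c *\<^sub>C x)) E"
  shows "blinfun_apply E v = cinner v x *\<^sub>C x"
proof -
  have bE: "E \<in> bounded_ops" and idem: "E o\<^sub>L E = E" and selfadj: "adj E = E"
    and ran: "range (blinfun_apply E) = range (\<lambda>c. c *\<^sub>C x)"
    using E by (auto simp: orth_projection_onto_def)
  have "x \<in> range (blinfun_apply E)"
    unfolding ran by (metis rangeI scaleC_one)
  then have Ex: "blinfun_apply E x = x"
    using idem by (metis blinfun_apply_blinfun_compose imageE)
  obtain c where c: "blinfun_apply E v = c *\<^sub>C x"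
    using ran by (metis imageE rangeI)
  have "cinner x x = 1"
    using \<open>norm x = 1\<close> by (simp add: cinner_self)
  then have "c = cinner (blinfun_apply E v) x"
    by (simp add: c cinner_scaleC_left)
  also have "\<dots> = cinner v x"
    using cinner_adj[OF bE, of v x] by (simp add: selfadj Ex)
  finally show ?thesis
    using c by simp
qed

theorem theorem9:
  fixes M :: "('h::complex_hilbert \<Rightarrow>\<^sub>L 'h) set"
    and x :: 'h
    and E :: "'h \<Rightarrow>\<^sub>L 'h"
    and k :: nat
    and A B :: "nat \<Rightarrow> 'h \<Rightarrow>\<^sub>L 'h"
    and \<phi> :: "('h \<Rightarrow>\<^sub>L 'h) \<Rightarrow> 'h \<Rightarrow>\<^sub>L 'h"
    and D\<^sub>\<phi> C\<^sub>\<phi> :: "'h \<Rightarrow>\<^sub>L 'h"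
  assumes "factor M" and "injective_vna M"
    and "norm x = 1" and "separating_vector M x" and "cyclic_vector M x"
    and "orth_projection_onto (range (\<lambda>c. c *\<^sub>C x)) E"
    and "\<forall>i\<in>{1..k}. A i \<in> M" and "\<forall>i\<in>{1..k}. B i \<in> M"
    and "\<forall>C\<in>M. \<phi> C = (\<Sum>i=1..k. A i o\<^sub>L C o\<^sub>L B i)"
    and "D\<^sub>\<phi> = (\<Sum>i=1..k. B i o\<^sub>L E o\<^sub>L A i)"
    and "C\<^sub>\<phi> = (\<Sum>i=1..k. A i o\<^sub>L E o\<^sub>L B i)"
  shows "(completely_positive_on M \<phi> \<longleftrightarrow>
            positive_map_on bounded_ops (\<lambda>C. \<Sum>i=1..k. A i o\<^sub>L C o\<^sub>L B i)) \<and>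
         (positive_map_on bounded_ops (\<lambda>C. \<Sum>i=1..k. A i o\<^sub>L C o\<^sub>L B i) \<longleftrightarrow>
            (\<exists>(m::nat) V. (\<forall>j\<in>{1..m}. V j \<in> M) \<and>
               (\<forall>C\<in>M. \<phi> C = (\<Sum>j=1..m. adj (V j) o\<^sub>L C o\<^sub>L V j)))) \<and>
         ((\<exists>(m::nat) V. (\<forall>j\<in>{1..m}. V j \<in> M) \<and>
               (\<forall>C\<in>M. \<phi> C = (\<Sum>j=1..m. adj (V j) o\<^sub>L C o\<^sub>L V j))) \<longleftrightarrow>
            positive_op D\<^sub>\<phi>) \<and>
         (positive_op D\<^sub>\<phi> \<longleftrightarrow> positive_op C\<^sub>\<phi>)"
proof -
  let ?\<Phi> = "\<lambda>C. \<Sum>i=1..k. A i o\<^sub>L C o\<^sub>L B i"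
  let ?Kraus = "\<exists>(m::nat) V. (\<forall>j\<in>{1..m}. V j \<in> M) \<and>
    (\<forall>C\<in>M. \<phi> C = (\<Sum>j=1..m. adj (V j) o\<^sub>L C o\<^sub>L V j))"
  have M: "von_neumann_algebra M"
    using assms(1) by (simp add: factor_def)
  have A: "A i \<in> M" and B: "B i \<in> M" if "i \<in> {1..k}" for i
    using assms(7,8) that by auto
  have \<phi>: "\<phi> C = ?\<Phi> C" if "C \<in> M" for C
    using assms(9) that by blast
  have bE: "E \<in> bounded_ops" and E_idem: "E o\<^sub>L E = E" and E_adj: "adj E = E"
    using assms(6) by (auto simp: orth_projection_onto_def)
  have E: "blinfun_apply E v = cinner v x *\<^sub>C x" for v
    by (rule orth_projection_onto_span[OF assms(3,6)])
  have posE: "positive_op E"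
    unfolding positive_op_def using bE cinner_commute[of x]
    by (simp add: E cinner_scaleC_left flip: complex_norm_square of_real_power)
  have lin: "clinear_on bounded_ops ?\<Phi>"
    using A vna_bounded[OF M] by (intro clinear_on_elementary) blast
  note decompose = positive_tensor_decomposition[OF M assms(4) bE E finite_atLeastAtMost]

  have pos_if: "positive_map_on bounded_ops ?\<Phi>"
    if "\<And>j. j \<in> {1..m} \<Longrightarrow> V j \<in> M"
      and "\<And>C. C \<in> bounded_ops \<Longrightarrow> ?\<Phi> C = (\<Sum>j=1..m. adj (V j) o\<^sub>L C o\<^sub>L V j)"
    for m :: nat and V
    unfolding positive_map_on_def using lin that vna_bounded[OF M]
    by (auto intro!: positive_op_sum positive_op_conjugate)
  have Kraus_if: ?Kraus
    if "\<And>j. j \<in> {1..m} \<Longrightarrow> V j \<in> M"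
      and "\<And>C. C \<in> bounded_ops \<Longrightarrow> ?\<Phi> C = (\<Sum>j=1..m. adj (V j) o\<^sub>L C o\<^sub>L V j)"
    for m :: nat and V
    using that \<phi> vna_bounded[OF M] by (intro exI[of _ m] exI[of _ V]) auto

  \<comment> \<open>(i) implies (v): writing \<open>E\<close> as \<open>E\<close> times
    \<open>E\<close> and moving one copy across the inner product gives the sum of the previous
    positivity lemma with \<open>T = E\<close>.\<close>
  have cp_imp_C: "positive_op C\<^sub>\<phi>" if cp: "completely_positive_on M \<phi>"
    unfolding positive_op_def assms(11)
  proof (intro conjI allI)
    show "?\<Phi> E \<in> bounded_ops"
      using A B vna_bounded[OF M] by (intro sum_in_bounded_ops compose_in_bounded_ops bE) auto
    fix y
    have "cinner (blinfun_apply (A i) (blinfun_apply E (blinfun_apply (B i) y))) y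
      = cinner (blinfun_apply E (blinfun_apply (B i) y))
          (blinfun_apply E (blinfun_apply (adj (A i)) y))" if "i \<in> {1..k}" for i
    proof -
      have "blinfun_apply E (blinfun_apply E v) = blinfun_apply E v" for v
        using E_idem by (metis blinfun_apply_blinfun_compose)
      then show ?thesis
        using cinner_adj[OF bE, of "blinfun_apply E (blinfun_apply (B i) y)"]
        by (simp add: E_adj cinner_adj[OF vna_bounded[OF M A[OF that]]])
    qed
    then have "cinner (blinfun_apply (?\<Phi> E) y) y
      = (\<Sum>i=1..k. cinner (blinfun_apply E (blinfun_apply (B i) y))
          (blinfun_apply E (blinfun_apply (adj (A i)) y)))"
      by (simp add: blinfun.sum_left cinner.sum_left)
    then show "cinner (blinfun_apply (?\<Phi> E) y) y \<in> \<real>\<^sub>\<ge>\<^sub>0"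
      using completely_positive_imp_positive[OF assms(1) A B \<phi> cp bE] by simp
  qed
  have C_imp: "positive_map_on bounded_ops ?\<Phi> \<and> ?Kraus \<and> positive_op D\<^sub>\<phi>" if C_pos: "positive_op C\<^sub>\<phi>"
  proof -
    obtain m V where V: "\<And>j. j \<in> {1..m::nat} \<Longrightarrow> V j \<in> M"
      and eq: "\<And>f. balanced f \<Longrightarrow>
        (\<Sum>i=1..k. f (A i) (B i)) = (\<Sum>j=1..m. f (adj (V j)) (V j))"
      using decompose[OF A B C_pos[unfolded assms(11)]] by blast
    have \<Phi>: "?\<Phi> C = (\<Sum>j=1..m. adj (V j) o\<^sub>L C o\<^sub>L V j)" if "C \<in> bounded_ops" for C
      by (rule eq[OF balanced_sandwich(1)[OF that]])
    have bV: "V j \<in> bounded_ops" if "j \<in> {1..m}" for j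
      by (rule vna_bounded[OF M V[OF that]])
    \<comment> \<open>Exchanging the factors in the same tensor identity turns the
      \<open>V j\<close> into their adjoints.\<close>
    have "D\<^sub>\<phi> = (\<Sum>j=1..m. adj (adj (V j)) o\<^sub>L E o\<^sub>L adj (V j))"
      unfolding assms(10) eq[OF balanced_sandwich(2)[OF bE]] using bV by (simp add: adj_adj)
    then have "positive_op D\<^sub>\<phi>"
      using bV posE by (auto intro!: positive_op_sum positive_op_conjugate adj_in_bounded_ops)
    then show ?thesis
      using pos_if[OF V \<Phi>] Kraus_if[OF V \<Phi>] by blast
  qed
  \<comment> \<open>(iv) implies (ii): the tensor with \<open>A\<close> and \<open>B\<close>
    exchanged is decomposed, and the exchange is undone by the second sandwich.\<close>
  have D_imp: "positive_map_on bounded_ops ?\<Phi>" if D_pos: "positive_op D\<^sub>\<phi>"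
  proof -
    obtain m V where V: "\<And>j. j \<in> {1..m::nat} \<Longrightarrow> V j \<in> M"
      and eq: "\<And>f. balanced f \<Longrightarrow>
        (\<Sum>i=1..k. f (B i) (A i)) = (\<Sum>j=1..m. f (adj (V j)) (V j))"
      using decompose[OF B A D_pos[unfolded assms(10)]] by blast
    have "?\<Phi> C = (\<Sum>j=1..m. adj (adj (V j)) o\<^sub>L C o\<^sub>L adj (V j))" if "C \<in> bounded_ops" for C
      using eq[OF balanced_sandwich(2)[OF that]] vna_bounded[OF M V] by (simp add: adj_adj)
    then show ?thesis
      using pos_if[of m "\<lambda>j. adj (V j)"] V vna_adj[OF M] by blast
  qed
  have pos_imp: "positive_op C\<^sub>\<phi>" if "positive_map_on bounded_ops ?\<Phi>"
    using that posE bE unfolding positive_map_on_def assms(11) by blast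
  have Kraus_imp: "completely_positive_on M \<phi>" if Kraus: ?Kraus
  proof -
    obtain m V where V: "\<And>j. j \<in> {1..m::nat} \<Longrightarrow> V j \<in> M"
      and eq: "\<And>C. C \<in> M \<Longrightarrow> \<phi> C = (\<Sum>j=1..m. adj (V j) o\<^sub>L C o\<^sub>L V j)"
      using Kraus by blast
    have "clinear_on M \<phi>"
      using lin \<phi> vna_bounded[OF M] vna_add[OF M] vna_scale[OF M] unfolding clinear_on_def
      by simp
    then show ?thesis
      using completely_positive_on_Kraus[of M "{1..m}" V \<phi>] V eq vna_bounded[OF M] by blast
  qed
  \<comment> \<open>Every condition leads to (v): (iii) through (i), (iv) through (ii). Conversely,
    (v) gives (ii), (iii) and (iv), and (i) through (iii).\<close>
  show ?thesis
    using cp_imp_C C_imp D_imp pos_imp Kraus_imp by blast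
qed

end
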